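(* Let $G$ be a finite group. If $\eta(G)<\frac54$, then $\eta(G)=1$, and $G$ is cyclic of squarefree order.
   Context: For a finite group $G$, $\mathrm{cyc}(G)$ denotes the number of cyclic subgroups of $G$ (including the trivial one), $\pi(G)$ denotes the number of distinct prime divisors of $|G|$ (so $\pi(1)=0$), and $\eta(G)=\mathrm{cyc}(G)/2^{\pi(G)}$. The trivial group counts as cyclic of squarefree order $1$. *)

theory Defs
  imports
    Complex_Main
    "HOL-Algebra.Elementary_Groups"
    "HOL-Computational_Algebra.Squarefree"
begin

definition cyclic_subgroups :: "('a, 'b) monoid_scheme \<Rightarrow> 'a set set" where
  "cyclic_subgroups G = {H. subgroup H G \<and> cyclic_group (G\<lparr>carrier := H\<rparr>)}"

definition cyc :: "('a, 'b) monoid_scheme \<Rightarrow> nat" where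
  "cyc G = card (cyclic_subgroups G)"

definition num_prime_divisors :: "('a, 'b) monoid_scheme \<Rightarrow> nat" where
  "num_prime_divisors G = card {p :: nat. prime p \<and> p dvd order G}"

definition eta :: "('a, 'b) monoid_scheme \<Rightarrow> real" where
  "eta G = real (cyc G) / 2 ^ num_prime_divisors G"

end

theory Submission
  imports
    "HOL-Algebra.Multiplicative_Group"
    "HOL-Algebra.Sylow"
    "HOL-Algebra.Group_Action"
    "HOL-Number_Theory.Totient"
    Defs
begin

text \<open>By Frobenius' theorem (proved by the double induction of Isaacs and Robinson), \<open>x\<^sup>n = 1\<close> has at
  least \<open>n\<close> solutions in \<open>G\<close> for each divisor \<open>n\<close> of \<open>|G|\<close>. Counting orbits of the power maps then gives
  Richards' theorem: \<open>G\<close> has at least as many cyclic subgroups as \<open>|G|\<close> has divisors. If \<open>|G|\<close> is not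
  squarefree, this yields \<open>\<eta>(G) \<ge> 3/2\<close>. If \<open>|G|\<close> is squarefree, Frobenius' theorem makes a Sylow
  subgroup \<open>N\<close> for the largest prime normal. Every cyclic subgroup of \<open>G/N\<close> is the image of at
  least two cyclic subgroups of \<open>G\<close>, and of at least three if its lifts do not centralize \<open>N\<close>. Hence
  \<open>\<eta>(G) \<ge> \<eta>(G/N)\<close>; and if \<open>G/N\<close> is cyclic but \<open>G\<close> is not, then at least half of the subgroups of
  \<open>G/N\<close> are of the second kind, so that \<open>\<eta>(G) \<ge> 2/2 + 1/4 = 5/4\<close>.\<close>

section \<open>Quotients and residues\<close>

lemma (in group) ex_quotient:
  assumes "N \<lhd> G"
  obtains Q :: "('a, 'b) monoid_scheme" and h
  where "group_hom G Q h" "h ` carrier G = carrier Q" "kernel G Q h = N"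
proof -
  interpret N: normal N G by fact
  define r where "r x = (SOME y. y \<in> N #> x)" for x
  define H where "H = G\<lparr>mult := \<lambda>a b. r (a \<otimes> b)\<rparr>"
  define Q where "Q = H\<lparr>carrier := r ` carrier G, one := r \<one>\<rparr>"
  have r: "r x \<in> N #> x" if "x \<in> carrier G" for x
    unfolding r_def using rcos_self[OF that N.subgroup_axioms] by (rule someI)
  have rc: "r x \<in> carrier G" if "x \<in> carrier G" for x
    using r[OF that] N.rcosets_carrier rcosetsI that N.subset r_coset_subset_G by blast
  have coset: "N #> r x = N #> x" if "x \<in> carrier G" for x
    using r[OF that] repr_independence that N.subgroup_axioms by metis
  have r_eq: "r x = r y \<longleftrightarrow> N #> x = N #> y" if "x \<in> carrier G" "y \<in> carrier G" for x y
    using coset that by (metis r_def)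
  have hom: "r \<in> hom G H"
  proof (rule homI)
    fix x y assume xy: "x \<in> carrier G" "y \<in> carrier G"
    have "N #> (r x \<otimes> r y) = (N #> r x) <#> (N #> r y)"
      using xy rc by (simp add: N.rcos_sum)
    also have "\<dots> = N #> (x \<otimes> y)"
      using xy by (simp add: coset N.rcos_sum)
    finally show "r (x \<otimes> y) = r x \<otimes>\<^bsub>H\<^esub> r y"
      using xy rc r_eq by (simp add: H_def)
  qed (use rc in \<open>simp add: H_def\<close>)
  have "group Q"
    using hom_imp_img_group[OF hom] by (simp add: Q_def)
  moreover have "r \<in> hom G Q"
    using hom by (auto simp: hom_def Q_def)
  ultimately have "group_hom G Q r"
    using is_group by (simp add: group_hom_def group_hom_axioms_def)
  moreover have "r ` carrier G = carrier Q"
    by (simp add: Q_def)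
  moreover have "kernel G Q r = N"
  proof -
    have "r x = r \<one> \<longleftrightarrow> x \<in> N" if "x \<in> carrier G" for x
      using that r_eq N.subset N.subgroup_axioms
      by (metis coset_join1 coset_join2 coset_mult_one one_closed)
    thus ?thesis
      using N.subset by (auto simp: kernel_def Q_def)
  qed
  ultimately show thesis by (rule that)
qed

lemma (in group_hom) order_kernel:
  assumes "h ` carrier G = carrier H"
  shows "order H * card (kernel G H h) = order G"
proof -
  have "card (carrier (G Mod kernel G H h)) = card (carrier H)"
    using FactGroup_iso_set[OF assms] by (auto simp: iso_def intro: bij_betw_same_card)
  thus ?thesis
    using G.lagrange[OF subgroup_kernel] by (simp add: order_def FactGroup_def)
qed

lemma coprime_shift:
  fixes k n d :: nat
  assumes "coprime k d" "n > 0"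
  obtains j where "coprime j n" "[j = k] (mod d)"
proof -
  define t where "t = \<Prod>{p \<in> prime_factors n. \<not> p dvd k}"
  have "coprime (k + d * t) n"
  proof (rule ccontr)
    assume "\<not> coprime (k + d * t) n"
    then obtain p where p: "prime p" "p dvd k + d * t" "p dvd n"
      by (metis coprime_iff_gcd_eq_1 gcd_nat.bounded_iff prime_factor_nat)
    show False
    proof (cases "p dvd k")
      case True
      hence "p dvd d * t" using p(2) by (simp add: dvd_add_right_iff)
      moreover have "\<not> p dvd d"
        using True assms(1) p(1) coprime_common_divisor not_prime_unit by metis
      ultimately have "p dvd t" using p(1) by (simp add: prime_dvd_mult_iff)
      then obtain q where "q \<in> prime_factors n" "\<not> q dvd k" "p dvd q"
        using p(1) by (auto simp: t_def prime_dvd_prod_iff)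
      thus False using True p(1) primes_dvd_imp_eq in_prime_factors_imp_prime by metis
    next
      case False
      hence "p dvd t" unfolding t_def
        using p assms(2) by (intro dvd_prodI) (auto simp: prime_factors_dvd)
      thus False using False p(2) by (metis dvd_add_left_iff dvd_mult)
    qed
  qed
  moreover have "[k + d * t = k] (mod d)" by (simp add: cong_def)
  ultimately show thesis by (rule that)
qed

lemma card_totatives_cong_le:
  fixes n d u v :: nat
  assumes "d dvd n" "n > 1" "coprime u d" "coprime v d"
  shows "card {k \<in> totatives n. [k = u] (mod d)} \<le> card {k \<in> totatives n. [k = v] (mod d)}"
proof -
  obtain w where w: "[u * w = 1] (mod d)"
    using cong_solve_coprime_nat[OF assms(3)] by auto
  have "coprime w d"
    unfolding coprime_iff_invertible_nat using w by (auto simp: mult.commute)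
  hence "coprime (w * v) d" using assms(4) by simp
  then obtain j where j: "coprime j n" "[j = w * v] (mod d)"
    using coprime_shift[of "w * v" d n] assms(2) by auto
  show ?thesis
  proof (rule card_inj_on_le)
    show "inj_on (\<lambda>k. k * j mod n) {k \<in> totatives n. [k = u] (mod d)}"
    proof (rule inj_onI)
      fix k l assume *: "k \<in> {k \<in> totatives n. [k = u] (mod d)}" "l \<in> {k \<in> totatives n. [k = u] (mod d)}"
        "k * j mod n = l * j mod n"
      hence "[k = l] (mod n)" using j(1) cong_mult_rcancel_nat by (simp add: cong_def[of "_ * _"])
      thus "k = l" using * totatives_less assms(2) cong_less_modulus_unique_nat by (metis mem_Collect_eq)
    qed
    show "(\<lambda>k. k * j mod n) ` {k \<in> totatives n. [k = u] (mod d)} \<subseteq> {k \<in> totatives n. [k = v] (mod d)}"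
    proof (rule image_subsetI)
      fix k assume k: "k \<in> {k \<in> totatives n. [k = u] (mod d)}"
      have "coprime (k * j mod n) n"
        using k j(1) assms(2) by (simp add: totatives_def)
      moreover from this have "k * j mod n > 0" using assms(2) by (cases "k * j mod n = 0") auto
      moreover have "[k * j mod n = v] (mod d)"
      proof -
        have "[k * j mod n = k * j] (mod d)"
          using assms(1) by (simp add: cong_def mod_mod_cancel)
        also have "[k * j = u * (w * v)] (mod d)" using k j(2) by (auto intro: cong_mult)
        also have "u * (w * v) = u * w * v" by simp
        also have "[u * w * v = 1 * v] (mod d)" using w cong_mult cong_refl by blast
        finally show ?thesis by simp
      qed
      ultimately show "k * j mod n \<in> {k \<in> totatives n. [k = v] (mod d)}"
        using assms(2) by (simp add: totatives_def less_imp_le)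
    qed
  qed simp
qed

lemma card_totatives_cong:
  fixes n d :: nat
  assumes "d dvd n" "n > 0"
  shows "totient d * card {k \<in> totatives n. [k = 1] (mod d)} = totient n"
proof (cases "d = 1")
  case True
  thus ?thesis by (simp add: totient_def)
next
  case False
  hence d: "d > 1" using assms by (cases "d = 0") auto
  hence n: "n > 1" using dvd_imp_le[OF assms] by linarith
  define F where "F u = {k \<in> totatives n. [k = u] (mod d)}" for u
  have "totatives n = (\<Union>u\<in>totatives d. F u)"
  proof (intro equalityI subsetI)
    fix k assume k: "k \<in> totatives n"
    hence "coprime k d" using assms(1) coprime_divisors[of k k d n] by (auto simp: totatives_def)
    hence "coprime (k mod d) d" using d by simp
    moreover from this have "k mod d > 0" using d by (cases "k mod d = 0") auto
    ultimately have "k mod d \<in> totatives d" using d by (simp add: totatives_def less_imp_le)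
    moreover have "k \<in> F (k mod d)" using k by (simp add: F_def cong_def)
    ultimately show "k \<in> (\<Union>u\<in>totatives d. F u)" by blast
  qed (auto simp: F_def)
  hence "totient n = card (\<Union>u\<in>totatives d. F u)" by (simp add: totient_def)
  also have "\<dots> = (\<Sum>u\<in>totatives d. card (F u))"
  proof (rule card_UN_disjoint)
    show "\<forall>u\<in>totatives d. \<forall>v\<in>totatives d. u \<noteq> v \<longrightarrow> F u \<inter> F v = {}"
    proof (intro ballI impI)
      fix u v assume "u \<in> totatives d" "v \<in> totatives d" "u \<noteq> v"
      hence "\<not> [u = v] (mod d)" using d totatives_less cong_less_modulus_unique_nat by blast
      thus "F u \<inter> F v = {}" unfolding F_def by (auto dest: cong_sym cong_trans)
    qed
  qed (simp_all add: F_def)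
  also have "\<dots> = (\<Sum>u\<in>totatives d. card (F 1))"
  proof (rule sum.cong)
    fix u assume "u \<in> totatives d"
    thus "card (F u) = card (F 1)" unfolding F_def
      using card_totatives_cong_le[OF assms(1) n] by (intro le_antisym) (auto simp: totatives_def)
  qed simp
  finally show ?thesis by (simp add: F_def totient_def)
qed

section \<open>Elements of a given order\<close>

lemma dvd_card_fibers:
  assumes "finite S" "\<And>x. x \<in> S \<Longrightarrow> t dvd card {y \<in> S. f y = f x}"
  shows "t dvd card S"
proof -
  have "card S = (\<Sum>c\<in>f ` S. card {y \<in> S. f y = c})"
    unfolding card_eq_sum by (rule sum.image_gen[OF assms(1)])
  thus ?thesis using assms(2) by (auto intro!: dvd_sum)
qed

definition roots_of_one :: "('a, 'b) monoid_scheme \<Rightarrow> nat \<Rightarrow> 'a set" where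
  "roots_of_one G n = {x \<in> carrier G. x [^]\<^bsub>G\<^esub> n = \<one>\<^bsub>G\<^esub>}"

context group
begin

lemma roots_of_one_iff: "x \<in> roots_of_one G n \<longleftrightarrow> x \<in> carrier G \<and> ord x dvd n"
  by (auto simp: roots_of_one_def pow_eq_id)

lemma roots_of_one_gcd: "roots_of_one G (gcd n (order G)) = roots_of_one G n"
  using ord_dvd_group_order by (auto simp: roots_of_one_iff)

lemma one_in_roots_of_one: "\<one> \<in> roots_of_one G n"
  by (simp add: roots_of_one_def)

lemma nat_pow_cong:
  assumes "x \<in> carrier G" "[a = b] (mod ord x)"
  shows "x [^] a = x [^] b"
proof -
  have "int (ord x) dvd int b - int a"
    using assms(2) cong_iff_dvd_diff cong_int_iff cong_sym by metis
  hence "x [^] int a = x [^] int b" using int_pow_eq[OF assms(1)] by blast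
  thus ?thesis by (simp add: int_pow_int)
qed

lemma subgroup_pow_card:
  assumes "subgroup K G" "x \<in> K"
  shows "x [^] card K = \<one>"
proof -
  interpret GK: group "G\<lparr>carrier := K\<rparr>" by (rule subgroup_imp_group[OF assms(1)])
  have "x [^]\<^bsub>G\<lparr>carrier := K\<rparr>\<^esub> card K = \<one>"
    using GK.pow_order_eq_1[of x] assms(2) by (simp add: order_def)
  thus ?thesis using nat_pow_consistent by simp
qed

lemma card_generators:
  assumes "finite (carrier G)" "x \<in> carrier G"
  shows "card {y \<in> carrier G. generate G {y} = generate G {x}} = totient (ord x)"
proof -
  have gen_le: "generate G {x [^] k} \<subseteq> generate G {x}" for k :: nat
    using assms generate_pow_on_finite_carrier[OF assms] nat_pow_closed
    by (intro generate_subgroup_incl generate_is_subgroup) auto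
  have fin: "finite (generate G {x})"
    using assms generate_in_carrier[of "{x}"] by (auto intro: finite_subset)
  have "{y \<in> carrier G. generate G {y} = generate G {x}} = (\<lambda>k. x [^] k) ` totatives (ord x)"
  proof (intro equalityI subsetI)
    fix y assume y: "y \<in> {y \<in> carrier G. generate G {y} = generate G {x}}"
    hence ord_y: "ord y = ord x" using generate_pow_card assms by simp
    have "y \<in> generate G {x}" using y generate.incl[of y "{y}" G] by auto
    then obtain k :: nat where k: "y = x [^] k"
      using generate_pow_on_finite_carrier[OF assms] by auto
    show "y \<in> (\<lambda>k. x [^] k) ` totatives (ord x)"
    proof (cases "ord x = 1")
      case True
      thus ?thesis using k assms ord_eq_1[of x] by (auto simp: totatives_def)
    next
      case False
      hence o: "ord x > 1" using ord_ge_1[OF assms] by simp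
      have k': "y = x [^] (k mod ord x)"
        unfolding k by (rule nat_pow_cong[OF assms(2)]) (simp add: cong_def)
      have "coprime k (ord x)"
        using pow_ord_eq_ord_iff[OF assms] ord_y k by simp
      hence "coprime (k mod ord x) (ord x)" using o by simp
      moreover from this have "k mod ord x > 0" using o by (cases "k mod ord x = 0") auto
      ultimately have "k mod ord x \<in> totatives (ord x)"
        using o by (simp add: totatives_def less_imp_le)
      thus ?thesis using k' by blast
    qed
  next
    fix y assume "y \<in> (\<lambda>k. x [^] k) ` totatives (ord x)"
    then obtain k where k: "y = x [^] k" "coprime k (ord x)" by (auto simp: totatives_def)
    hence "ord y = ord x" using pow_ord_eq_ord_iff[OF assms] by simp
    hence "card (generate G {y}) = card (generate G {x})"
      using generate_pow_card assms k by simp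
    hence "generate G {y} = generate G {x}"
      using gen_le fin k(1) card_subset_eq by blast
    thus "y \<in> {y \<in> carrier G. generate G {y} = generate G {x}}" using k assms by simp
  qed
  moreover have "inj_on (\<lambda>k. x [^] k) (totatives (ord x))"
    using ord_inj'[OF assms(2)] by (rule inj_on_subset) (auto simp: totatives_def)
  ultimately show ?thesis by (simp add: card_image totient_def)
qed

lemma dvd_card_generator_closed:
  assumes "finite (carrier G)" "S \<subseteq> carrier G"
    and closed: "\<And>x y. x \<in> S \<Longrightarrow> y \<in> carrier G \<Longrightarrow> generate G {y} = generate G {x} \<Longrightarrow> y \<in> S"
    and dvd: "\<And>x. x \<in> S \<Longrightarrow> t dvd totient (ord x)"
  shows "t dvd card S"
proof (rule dvd_card_fibers[where f = "\<lambda>x. generate G {x}"])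
  fix x assume x: "x \<in> S"
  have "{y \<in> S. generate G {y} = generate G {x}} = {y \<in> carrier G. generate G {y} = generate G {x}}"
    using assms(2) closed[OF x] by auto
  thus "t dvd card {y \<in> S. generate G {y} = generate G {x}}"
    using card_generators assms(1,2) dvd[OF x] x by auto
qed (use assms finite_subset in blast)

lemma dvd_card_ord_class:
  assumes "finite (carrier G)" "\<And>x. x \<in> carrier G \<Longrightarrow> P (ord x) \<Longrightarrow> t dvd totient (ord x)"
  shows "t dvd card {x \<in> carrier G. P (ord x)}"
proof (rule dvd_card_generator_closed)
  fix x y assume "x \<in> {x \<in> carrier G. P (ord x)}" "y \<in> carrier G" "generate G {y} = generate G {x}"
  thus "y \<in> {x \<in> carrier G. P (ord x)}" using generate_pow_card by auto
qed (use assms in auto)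

definition centralizer :: "'a \<Rightarrow> 'a set" where
  "centralizer u = {g \<in> carrier G. g \<otimes> u = u \<otimes> g}"

lemma conj_eq_self_iff:
  assumes "g \<in> carrier G" "u \<in> carrier G"
  shows "g \<otimes> u \<otimes> inv g = u \<longleftrightarrow> g \<otimes> u = u \<otimes> g"
  using assms by (metis inv_solve_right m_closed)

lemma conj_class_centralizer:
  assumes "u \<in> carrier G"
  shows "subgroup (centralizer u) G"
    and "card ((\<lambda>g. g \<otimes> u \<otimes> inv g) ` carrier G) * card (centralizer u) = order G"
proof -
  interpret A: group_action G "carrier G" "\<lambda>g. \<lambda>h \<in> carrier G. g \<otimes> h \<otimes> inv g"
    by (rule action_by_conjugation)
  have st: "stabilizer G (\<lambda>g. \<lambda>h \<in> carrier G. g \<otimes> h \<otimes> inv g) u = centralizer u"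
    using assms conj_eq_self_iff by (auto simp: stabilizer_def centralizer_def)
  have "orbit G (\<lambda>g. \<lambda>h \<in> carrier G. g \<otimes> h \<otimes> inv g) u = (\<lambda>g. g \<otimes> u \<otimes> inv g) ` carrier G"
    using assms by (auto simp: orbit_def)
  thus "subgroup (centralizer u) G"
    and "card ((\<lambda>g. g \<otimes> u \<otimes> inv g) ` carrier G) * card (centralizer u) = order G"
    using A.stabilizer_subgroup[OF assms] A.orbit_stabilizer_theorem[OF assms] st by simp_all
qed

lemma conj_pow:
  assumes "g \<in> carrier G" "x \<in> carrier G"
  shows "(g \<otimes> x \<otimes> inv g) [^] (n::nat) = g \<otimes> x [^] n \<otimes> inv g"
proof (induction n)
  case (Suc n)
  have "inv g \<otimes> (g \<otimes> (x \<otimes> inv g)) = x \<otimes> inv g"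
    using assms m_assoc[of "inv g" g "x \<otimes> inv g"] by simp
  thus ?case using assms Suc by (simp add: m_assoc)
qed (use assms in simp)

end

lemma (in group_hom) card_roots_of_one_central:
  assumes "finite (carrier G)" "h ` carrier G = carrier H"
    and central: "\<And>x y. x \<in> kernel G H h \<Longrightarrow> y \<in> carrier G \<Longrightarrow> x \<otimes> y = y \<otimes> x"
    and cop: "coprime m (card (kernel G H h))"
  shows "card (roots_of_one G m) = card (roots_of_one H m)"
proof (rule bij_betw_same_card)
  let ?K = "kernel G H h"
  have K_iff: "x \<in> ?K \<longleftrightarrow> x \<in> carrier G \<and> h x = \<one>\<^bsub>H\<^esub>" for x
    by (simp add: kernel_def)
  note K_pow = G.subgroup_pow_card[OF subgroup_kernel]
  have K_triv: "x = \<one>" if "x \<in> ?K" "x [^] m = \<one>" for x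
  proof -
    have "x \<in> carrier G" using that by (simp add: K_iff)
    hence "G.ord x dvd m" "G.ord x dvd card ?K" using that K_pow by (simp_all flip: G.pow_eq_id)
    thus ?thesis using cop G.ord_eq_1 \<open>x \<in> carrier G\<close> coprime_common_divisor_nat by blast
  qed
  show "bij_betw h (roots_of_one G m) (roots_of_one H m)"
    unfolding bij_betw_def
  proof
    show "inj_on h (roots_of_one G m)"
    proof (rule inj_onI)
      fix x y assume x: "x \<in> roots_of_one G m" and y: "y \<in> roots_of_one G m" and eq: "h x = h y"
      hence xy: "x \<in> carrier G" "y \<in> carrier G" "x [^] m = \<one>" "y [^] m = \<one>"
        by (auto simp: roots_of_one_def)
      define z where "z = x \<otimes> inv y"
      have zG: "z \<in> carrier G" using xy by (simp add: z_def)
      have "h z = h x \<otimes>\<^bsub>H\<^esub> inv\<^bsub>H\<^esub> h x" unfolding z_def using xy eq by (metis G.inv_closed hom_inv hom_mult)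
      hence z: "z \<in> ?K" using xy zG by (simp add: K_iff)
      have x_eq: "x = z \<otimes> y" using xy by (simp add: z_def G.m_assoc)
      have "x [^] m = z [^] m \<otimes> y [^] m"
        unfolding x_eq using central[OF z xy(2)] zG xy(2) by (rule G.pow_mult_distrib)
      hence "z [^] m = \<one>" unfolding xy using zG by simp
      thus "x = y" using K_triv[OF z] x_eq xy by simp
    qed
    show "h ` roots_of_one G m = roots_of_one H m"
    proof (intro equalityI subsetI)
      fix z assume "z \<in> roots_of_one H m"
      hence z: "z \<in> carrier H" "z [^]\<^bsub>H\<^esub> m = \<one>\<^bsub>H\<^esub>" by (auto simp: roots_of_one_def)
      hence "z \<in> h ` carrier G" using assms(2) by simp
      then obtain y where y: "y \<in> carrier G" "h y = z" by blast
      obtain b where b: "[b = 1] (mod m)" "[b = 0] (mod (card ?K))"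
        using binary_chinese_remainder_nat[OF cop] by blast
      from b(2) obtain c where c: "b = card ?K * c" by (auto simp: cong_0_iff)
      have "z [^]\<^bsub>H\<^esub> b = z"
      proof -
        have "H.ord z dvd m" using z by (simp flip: H.pow_eq_id)
        hence "[b = 1] (mod (H.ord z))" using b(1) cong_dvd_modulus_nat by blast
        hence "z [^]\<^bsub>H\<^esub> b = z [^]\<^bsub>H\<^esub> (1::nat)" by (rule H.nat_pow_cong[OF z(1)])
        thus ?thesis using z(1) by simp
      qed
      hence "h (y [^] b) = z" using y by (simp add: hom_nat_pow)
      moreover have "y [^] m \<in> ?K" using y z by (simp add: K_iff hom_nat_pow)
      hence "(y [^] m) [^] card ?K = \<one>" by (rule K_pow)
      hence "((y [^] m) [^] card ?K) [^] c = \<one>" by simp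
      hence "(y [^] b) [^] m = \<one>"
        using y(1) by (simp add: G.nat_pow_pow c ac_simps)
      ultimately show "z \<in> h ` roots_of_one G m"
        using y by (auto simp: roots_of_one_def intro!: image_eqI[of _ _ "y [^] b"])
    next
      fix z assume "z \<in> h ` roots_of_one G m"
      then obtain y where y: "y \<in> carrier G" "y [^] m = \<one>" "z = h y"
        by (auto simp: roots_of_one_def)
      hence "z [^]\<^bsub>H\<^esub> m = \<one>\<^bsub>H\<^esub>" using hom_nat_pow[OF y(1), of m] by simp
      thus "z \<in> roots_of_one H m" using y by (simp add: roots_of_one_def)
    qed
  qed
qed

section \<open>Frobenius' theorem\<close>

lemma (in group) dvd_card_conj_class_times_roots:
  assumes fin: "finite (carrier G)" and u: "u \<in> carrier G" "ord u > 1"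
    and cop: "coprime m (ord u)" and m: "m dvd order G"
    and IH: "\<And>(Q :: ('a, 'b) monoid_scheme) n. group Q \<Longrightarrow> finite (carrier Q) \<Longrightarrow>
      order Q < order G \<Longrightarrow> n dvd order Q \<Longrightarrow> n dvd card (roots_of_one Q n)"
  shows "m dvd card ((\<lambda>g. g \<otimes> u \<otimes> inv g) ` carrier G) * card {w \<in> centralizer u. w [^] m = \<one>}"
proof -
  define C where "C = G\<lparr>carrier := centralizer u\<rparr>"
  have sub: "subgroup (centralizer u) G" by (rule conj_class_centralizer(1)[OF u(1)])
  interpret C: group C unfolding C_def by (rule subgroup_imp_group[OF sub])
  have carr_C: "carrier C = centralizer u" by (simp add: C_def)
  have finC: "finite (carrier C)"
    unfolding carr_C using fin subgroup.subset[OF sub] by (rule finite_subset[rotated])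
  have "generate G {u} \<subseteq> centralizer u"
    using u by (intro generate_subgroup_incl[OF _ sub]) (simp add: centralizer_def)
  hence sub_gen: "subgroup (generate G {u}) C"
    unfolding C_def using subgroup_incl sub generate_is_subgroup[of "{u}"] u by simp
  have central: "x \<otimes> y = y \<otimes> x" if xy: "x \<in> generate G {u}" "y \<in> centralizer u" for x y
  proof -
    obtain k :: nat where k: "x = u [^] k"
      using xy(1) unfolding generate_pow_on_finite_carrier[OF fin u(1)] by blast
    have y: "y \<in> carrier G" "u \<otimes> y = y \<otimes> u" using xy(2) by (auto simp: centralizer_def)
    show ?thesis unfolding k by (rule group_commutes_pow) (use y u in auto)
  qed
  have "generate G {u} \<lhd> C"
    unfolding C.normal_inv_iff
  proof (intro conjI ballI)
    fix x y assume xy: "x \<in> carrier C" "y \<in> generate G {u}"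
    have yC: "y \<in> carrier C" using xy(2) subgroup.subset[OF sub_gen] by auto
    have "x \<otimes>\<^bsub>C\<^esub> y = y \<otimes>\<^bsub>C\<^esub> x" using central[OF xy(2)] xy(1) by (simp add: C_def)
    hence "x \<otimes>\<^bsub>C\<^esub> y \<otimes>\<^bsub>C\<^esub> inv\<^bsub>C\<^esub> x = y"
      using C.conj_eq_self_iff xy(1) yC by blast
    thus "x \<otimes>\<^bsub>C\<^esub> y \<otimes>\<^bsub>C\<^esub> inv\<^bsub>C\<^esub> x \<in> generate G {u}" using xy(2) by simp
  qed (rule sub_gen)
  from C.ex_quotient[OF this] obtain Q :: "('a, 'b) monoid_scheme" and h
    where Q: "group_hom C Q h" "h ` carrier C = carrier Q" "kernel C Q h = generate G {u}" by blast
  interpret Q: group_hom C Q h by (rule Q)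
  have card_gen: "card (generate G {u}) = ord u" using generate_pow_card[OF u(1)] by simp
  have ord_Q: "order Q * ord u = order C"
    using Q.order_kernel[OF Q(2)] Q(3) card_gen by simp
  have ord_C: "card ((\<lambda>g. g \<otimes> u \<otimes> inv g) ` carrier G) * order C = order G"
    using conj_class_centralizer(2)[OF u(1)] by (simp add: order_def carr_C)
  have "order C > 0" using C.order_gt_0_iff_finite finC by blast
  hence "order Q > 0" unfolding ord_Q[symmetric] by simp
  hence "order Q < order C" unfolding ord_Q[symmetric] using u(2) by simp
  also have "order C \<le> order G"
    unfolding order_def carr_C using fin subgroup.subset[OF sub] by (rule card_mono)
  finally have less: "order Q < order G" .
  have finQ: "finite (carrier Q)" using finC Q(2) by (metis finite_imageI)
  have "gcd m (order Q) dvd card (roots_of_one Q (gcd m (order Q)))"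
    using Q.H.is_group finQ less by (intro IH) auto
  also have "\<dots> = card (roots_of_one C m)"
    unfolding Q.H.roots_of_one_gcd
    using finC Q(2) central cop
    by (intro Q.card_roots_of_one_central[symmetric]) (auto simp: Q(3) card_gen carr_C, simp add: C_def)
  also have "roots_of_one C m = {w \<in> centralizer u. w [^] m = \<one>}"
    by (auto simp: roots_of_one_def C_def simp flip: nat_pow_consistent)
  finally have *: "gcd m (order Q) dvd card {w \<in> centralizer u. w [^] m = \<one>}" .
  let ?c = "card ((\<lambda>g. g \<otimes> u \<otimes> inv g) ` carrier G)"
  have "m dvd (?c * order Q) * ord u" using m ord_C ord_Q by (simp add: mult.assoc)
  hence "m dvd ?c * order Q" using cop coprime_dvd_mult_left_iff by blast
  hence "m dvd gcd (?c * m) (?c * order Q)" by simp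
  hence "m dvd ?c * gcd m (order Q)" by (simp add: gcd_mult_distrib_nat)
  also have "\<dots> dvd ?c * card {w \<in> centralizer u. w [^] m = \<one>}" using * by (rule mult_dvd_mono[OF dvd_refl])
  finally show ?thesis .
qed

text \<open>Every element counted here is uniquely \<open>u w = w u\<close> with \<open>ord u = p^(a+1)\<close> and \<open>w\<^sup>m = 1\<close>;
  the exponent \<open>e\<close> projects to \<open>u\<close>.\<close>

lemma (in group) dvd_card_new_roots:
  fixes p a m :: nat
  assumes fin: "finite (carrier G)" and p: "prime p" "\<not> p dvd m"
    and m: "m dvd order G"
    and IH: "\<And>(Q :: ('a, 'b) monoid_scheme) n. group Q \<Longrightarrow> finite (carrier Q) \<Longrightarrow>
      order Q < order G \<Longrightarrow> n dvd order Q \<Longrightarrow> n dvd card (roots_of_one Q n)"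
  shows "p ^ a * m dvd card (roots_of_one G (p ^ Suc a * m) - roots_of_one G (p ^ a * m))"
proof -
  let ?P = "p ^ Suc a"
  define S where "S = roots_of_one G (?P * m) - roots_of_one G (p ^ a * m)"
  have cop: "coprime m p" using p prime_imp_coprime coprime_commute by blast
  hence copP: "coprime m ?P" by simp
  have S_iff: "x \<in> S \<longleftrightarrow> x \<in> carrier G \<and> ord x dvd ?P * m \<and> \<not> ord x dvd p ^ a * m" for x
    by (auto simp: S_def roots_of_one_iff)
  have finS: "finite S" using fin S_iff by (auto intro: finite_subset)
  have P_dvd: "?P dvd k" if k: "k dvd ?P * m" "\<not> k dvd p ^ a * m" for k
  proof -
    obtain b c where bc: "k = b * c" "b dvd ?P" "c dvd m" using division_decomp[OF k(1)] by blast
    then obtain i where i: "i \<le> Suc a" "b = p ^ i" using divides_primepow_nat[OF p(1)] by blast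
    have "i = Suc a"
    proof (rule ccontr)
      assume "i \<noteq> Suc a"
      hence "b dvd p ^ a" using i by (simp add: le_imp_power_dvd)
      thus False using k(2) bc(1,3) mult_dvd_mono by blast
    qed
    thus ?thesis using i bc by simp
  qed
  have "p ^ a dvd card S"
  proof -
    have "p ^ a dvd totient (ord x)" if "x \<in> carrier G" "ord x dvd ?P * m \<and> \<not> ord x dvd p ^ a * m" for x
    proof -
      have "p ^ a dvd totient ?P" using p(1) by (simp add: totient_prime_power_Suc del: power_Suc)
      also have "\<dots> dvd totient (ord x)" using that P_dvd by (intro totient_dvd) auto
      finally show ?thesis .
    qed
    from dvd_card_ord_class[OF fin this] have "p ^ a dvd card {x \<in> carrier G. ord x dvd ?P * m \<and> \<not> ord x dvd p ^ a * m}" .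
    also have "{x \<in> carrier G. ord x dvd ?P * m \<and> \<not> ord x dvd p ^ a * m} = S" using S_iff by auto
    finally show ?thesis .
  qed
  moreover have "m dvd card S"
  proof -
    obtain e where e: "[e = 0] (mod m)" "[e = 1] (mod ?P)"
      using binary_chinese_remainder_nat[OF copP] by blast
    have m_e: "m dvd e" using e(1) by (simp add: cong_0_iff)
    have cop_e: "coprime e p"
      using cong_imp_coprime[OF cong_sym[OF e(2)]] by simp
    define cls where "cls u = (\<lambda>g. g \<otimes> u \<otimes> inv g) ` carrier G" for u
    have cls_self: "u \<in> cls u" if "u \<in> carrier G" for u
      unfolding cls_def using that by (intro image_eqI[of _ _ \<one>]) auto
    have cls_trans: "cls v \<subseteq> cls u" if uv: "u \<in> carrier G" "v \<in> cls u" for u v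
    proof
      fix w assume "w \<in> cls v"
      then obtain g where g: "g \<in> carrier G" "w = g \<otimes> v \<otimes> inv g" by (auto simp: cls_def)
      from uv obtain k where k: "k \<in> carrier G" "v = k \<otimes> u \<otimes> inv k" by (auto simp: cls_def)
      have "w = (g \<otimes> k) \<otimes> u \<otimes> inv (g \<otimes> k)"
        using g k uv by (simp add: m_assoc inv_mult_group)
      thus "w \<in> cls u" unfolding cls_def using g k by auto
    qed
    have cls_sym: "u \<in> cls v" if uv: "u \<in> carrier G" "v \<in> cls u" for u v
    proof -
      from uv obtain k where k: "k \<in> carrier G" "v = k \<otimes> u \<otimes> inv k" by (auto simp: cls_def)
      have "inv k \<otimes> (k \<otimes> u) = u" using k uv m_assoc[of "inv k" k u] by simp
      hence "u = inv k \<otimes> v \<otimes> inv (inv k)" using k uv by (simp add: m_assoc)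
      moreover have "inv k \<in> carrier G" using k by simp
      ultimately show ?thesis unfolding cls_def by (rule image_eqI)
    qed
    have cls_carr: "v \<in> carrier G" if "u \<in> carrier G" "v \<in> cls u" for u v
      using that by (auto simp: cls_def)
    have cls_eq: "cls v = cls u \<longleftrightarrow> v \<in> cls u" if "u \<in> carrier G" "v \<in> carrier G" for u v
      using cls_self cls_trans cls_sym that by blast
    show ?thesis
    proof (rule dvd_card_fibers[where f = "\<lambda>x. cls (x [^] e)", OF finS])
      fix x assume x: "x \<in> S"
      define u where "u = x [^] e"
      have xG: "x \<in> carrier G" using x S_iff by blast
      hence uG: "u \<in> carrier G" by (simp add: u_def)
      have ord_u: "ord u = ?P"
      proof -
        have "ord x dvd e * ?P" using x S_iff m_e by (metis dvd_trans mult.commute mult_dvd_mono dvd_refl)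
        hence "u [^] ?P = \<one>" using xG by (simp add: u_def nat_pow_pow pow_eq_id del: power_Suc)
        hence "ord u dvd ?P" using uG by (simp add: pow_eq_id del: power_Suc)
        moreover have "\<not> ord u dvd p ^ a"
        proof
          assume "ord u dvd p ^ a"
          hence "u [^] (p ^ a) = \<one>" using uG by (simp add: pow_eq_id)
          hence "ord x dvd e * p ^ a" using xG by (simp add: u_def nat_pow_pow pow_eq_id)
          moreover have "?P dvd ord x" using x S_iff P_dvd by blast
          ultimately have "?P dvd e * p ^ a" by (rule dvd_trans[rotated])
          hence "p dvd e" using p(1) by (simp add: prime_gt_0_nat)
          thus False using cop_e p(1) by (metis coprime_common_divisor dvd_refl not_prime_unit)
        qed
        ultimately show ?thesis
          using P_dvd[of "ord u"]
          by (metis dvd_antisym divides_primepow_nat le_Suc_eq le_imp_power_dvd p(1))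
      qed
      have "1 < ord u" unfolding ord_u using prime_gt_1_nat[OF p(1)] by (intro one_less_power) auto
      moreover have "coprime m (ord u)" unfolding ord_u by (rule copP)
      ultimately have dvd_fiber: "m dvd card (cls u) * card {w \<in> centralizer u. w [^] m = \<one>}"
        unfolding cls_def by (rule dvd_card_conj_class_times_roots[OF fin uG _ _ m IH])
      define F where "F v = {y \<in> S. y [^] e = v}" for v
      have F_conj_le: "card (F v) \<le> card (F w)" if vw: "v \<in> carrier G" "w \<in> cls v" for v w
      proof -
        obtain g where g: "g \<in> carrier G" "w = g \<otimes> v \<otimes> inv g" using vw by (auto simp: cls_def)
        show ?thesis
        proof (rule card_inj_on_le)
          show "inj_on (\<lambda>y. g \<otimes> y \<otimes> inv g) (F v)"
            using g(1) by (auto simp: inj_on_def F_def S_iff)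
          show "(\<lambda>y. g \<otimes> y \<otimes> inv g) ` F v \<subseteq> F w"
          proof (rule image_subsetI)
            fix y assume y: "y \<in> F v"
            hence yG: "y \<in> carrier G" by (simp add: F_def S_iff)
            have pow: "(g \<otimes> y \<otimes> inv g) [^] (n::nat) = \<one> \<longleftrightarrow> y [^] n = \<one>" for n
            proof -
              have "g \<otimes> y [^] n \<otimes> inv g = \<one> \<longleftrightarrow> g \<otimes> y [^] n = g"
                using g(1) yG by (metis inv_solve_right' l_one m_closed nat_pow_closed one_closed)
              thus ?thesis using g(1) yG by (simp add: conj_pow)
            qed
            have "ord (g \<otimes> y \<otimes> inv g) dvd n \<longleftrightarrow> ord y dvd n" for n
              using pow[of n] g(1) yG by (simp add: pow_eq_id)
            thus "g \<otimes> y \<otimes> inv g \<in> F w" using y g yG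
              by (simp add: F_def S_iff conj_pow del: power_Suc)
          qed
          show "finite (F w)" using finS by (simp add: F_def)
        qed
      qed
      have "{y \<in> S. cls (y [^] e) = cls u} = (\<Union>v\<in>cls u. F v)"
        using cls_eq[OF uG] S_iff by (auto simp: F_def)
      also have "card \<dots> = (\<Sum>v\<in>cls u. card (F v))"
        using finS fin by (intro card_UN_disjoint) (auto simp: F_def cls_def)
      also have "\<dots> = (\<Sum>v\<in>cls u. card (F u))"
        using F_conj_le uG cls_carr[OF uG] cls_sym[OF uG] by (intro sum.cong refl le_antisym) auto
      also have "\<dots> = card (cls u) * card (F u)" by simp
      also have "card (F u) = card {w \<in> centralizer u. w [^] m = \<one>}"
      proof (rule bij_betw_same_card, rule bij_betw_byWitness[where f' = "\<lambda>w. u \<otimes> w"])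
        show "\<forall>y\<in>F u. u \<otimes> (inv u \<otimes> y) = y"
          using uG by (auto simp: F_def S_iff m_assoc[symmetric])
        show "\<forall>w\<in>{w \<in> centralizer u. w [^] m = \<one>}. inv u \<otimes> (u \<otimes> w) = w"
          using uG by (auto simp: centralizer_def m_assoc[symmetric])
        show "(\<lambda>y. inv u \<otimes> y) ` F u \<subseteq> {w \<in> centralizer u. w [^] m = \<one>}"
        proof (rule image_subsetI)
          fix y assume y: "y \<in> F u"
          hence yG: "y \<in> carrier G" and ye: "u = y [^] e" and ord_y: "ord y dvd ?P * m"
            by (auto simp: F_def S_iff)
          have comm: "y \<otimes> u = u \<otimes> y" unfolding ye using nat_pow_comm[of y 1 e] yG by simp
          have comm': "inv u \<otimes> y = y \<otimes> inv u"
            using comm uG yG by (metis inv_closed inv_solve_left inv_solve_right m_assoc m_closed)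
          have "inv u \<otimes> y \<otimes> u = u \<otimes> (inv u \<otimes> y)"
            using uG yG m_assoc[of "inv u" u y] m_assoc[of u "inv u" y] by (simp add: m_assoc comm)
          moreover have "(inv u \<otimes> y) [^] m = \<one>"
          proof -
            have "[e * m = 1 * m] (mod (?P * m))" using e(2)
              by (metis cong_def mult_mod_left)
            hence "[e * m = m] (mod ord y)" using ord_y cong_dvd_modulus_nat by simp
            hence "y [^] (e * m) = y [^] m" by (rule nat_pow_cong[OF yG])
            hence "u [^] m = y [^] m" unfolding ye using yG by (simp add: nat_pow_pow)
            moreover have "(inv u \<otimes> y) [^] m = inv u [^] m \<otimes> y [^] m"
              using comm' uG yG by (intro pow_mult_distrib) auto
            ultimately show ?thesis using uG by (metis nat_pow_closed nat_pow_inv l_inv)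
          qed
          ultimately show "inv u \<otimes> y \<in> {w \<in> centralizer u. w [^] m = \<one>}"
            using uG yG by (simp add: centralizer_def)
        qed
        show "(\<lambda>w. u \<otimes> w) ` {w \<in> centralizer u. w [^] m = \<one>} \<subseteq> F u"
        proof (rule image_subsetI)
          fix w assume "w \<in> {w \<in> centralizer u. w [^] m = \<one>}"
          hence w: "w \<in> carrier G" "u \<otimes> w = w \<otimes> u" "w [^] m = \<one>" by (auto simp: centralizer_def)
          have pow: "(u \<otimes> w) [^] k = u [^] k" if "m dvd k" for k
          proof -
            have "w [^] k = \<one>" using w that by (auto simp: pow_eq_id)
            thus ?thesis using w(1,2) uG by (simp add: pow_mult_distrib)
          qed
          have "(u \<otimes> w) [^] e = u [^] e" by (rule pow[OF m_e])
          also have "\<dots> = u [^] (1::nat)" using e(2) by (intro nat_pow_cong uG) (simp add: ord_u del: power_Suc)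
          finally have "(u \<otimes> w) [^] e = u" using uG by simp
          moreover have "ord (u \<otimes> w) dvd k \<longleftrightarrow> ?P dvd k" if "m dvd k" for k
            using pow[OF that] w uG ord_u by (metis m_closed pow_eq_id)
          hence "ord (u \<otimes> w) dvd ?P * m" "\<not> ord (u \<otimes> w) dvd p ^ a * m"
            using copP p by (auto simp: coprime_commute coprime_dvd_mult_left_iff prime_gt_0_nat)
          ultimately show "u \<otimes> w \<in> F u" using uG w by (simp add: F_def S_iff)
        qed
      qed
      finally show "m dvd card {y \<in> S. cls (y [^] e) = cls (x [^] e)}"
        unfolding u_def[symmetric] using dvd_fiber by simp
    qed
  qed
  ultimately have "p ^ a * m dvd card S" using cop by (intro divides_mult) (simp_all add: coprime_commute)
  thus ?thesis by (simp add: S_def)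
qed

theorem frobenius_dvd_card_roots:
  fixes G :: "('a, 'b) monoid_scheme"
  assumes "group G" "finite (carrier G)" "n dvd order G"
  shows "n dvd card (roots_of_one G n)"
  using assms
proof (induction "order G" arbitrary: G n rule: less_induct)
  case (less G)
  interpret group G by (rule less.prems)
  have pos: "order G > 0" using order_gt_0_iff_finite less.prems by blast
  have fin: "finite (carrier G)" by (rule less.prems)
  have IH: "k dvd card (roots_of_one Q k)"
    if "group Q" "finite (carrier Q)" "order Q < order G" "k dvd order Q"
    for Q :: "('a, 'b) monoid_scheme" and k
    using less.hyps that by blast
  show ?case using less.prems(3)
  proof (induction "order G div n" arbitrary: n rule: less_induct)
    case (less n)
    have n: "n > 0" using less.prems pos by (auto intro: Nat.gr0I)
    show ?case
    proof (cases "n = order G")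
      case True
      have "roots_of_one G n = carrier G" using True ord_dvd_group_order by (auto simp: roots_of_one_iff)
      thus ?thesis using True by (simp add: order_def)
    next
      case False
      then obtain p where p: "prime p" "p dvd order G div n"
        using less.prems by (metis prime_factor_nat dvd_mult_div_cancel mult.right_neutral)
      hence np: "n * p dvd order G" using less.prems by (metis dvd_mult_div_cancel mult_dvd_mono dvd_refl)
      have "order G div (n * p) < order G div n"
        using p np n pos less.prems
        by (metis div_mult2_eq div_less_dividend dvd_div_eq_0_iff neq0_conv prime_gt_1_nat)
      hence "n * p dvd card (roots_of_one G (n * p))" using less.hyps np by blast
      hence IH1: "n dvd card (roots_of_one G (n * p))" by (rule dvd_mult_left)
      define a where "a = multiplicity p n"
      obtain m where m: "n = p ^ a * m" "\<not> p dvd m"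
        using multiplicity_decompose'[of n p] p(1) n not_prime_unit unfolding a_def
        by (metis less_irrefl)
      have "m dvd order G" using less.prems m by (metis dvd_mult_right)
      have "p ^ a * m dvd card (roots_of_one G (p ^ Suc a * m) - roots_of_one G (p ^ a * m))"
        by (rule dvd_card_new_roots[OF fin p(1) m(2) \<open>m dvd order G\<close> IH])
      hence "n dvd card (roots_of_one G (n * p) - roots_of_one G n)" by (simp add: m mult_ac)
      moreover have "roots_of_one G n \<subseteq> roots_of_one G (n * p)" by (auto simp: roots_of_one_iff)
      moreover have "finite (roots_of_one G (n * p))"
        using fin by (simp add: roots_of_one_def)
      ultimately have "card (roots_of_one G (n * p)) =
          card (roots_of_one G (n * p) - roots_of_one G n) + card (roots_of_one G n)"
        by (metis add.commute card_Diff_subset card_mono finite_subset le_add_diff_inverse)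
      thus ?thesis
        using IH1 \<open>n dvd card (roots_of_one G (n * p) - roots_of_one G n)\<close>
        by (simp add: dvd_add_right_iff)
    qed
  qed
qed

section \<open>Richards' theorem\<close>

lemma cong_one_iff_dvd_diff:
  fixes k d :: nat
  assumes "k > 0"
  shows "[k = 1] (mod d) \<longleftrightarrow> d dvd k - 1"
  using assms by (simp add: cong_altdef_nat)

lemma sum_card_swap:
  assumes "finite A" "finite B"
  shows "(\<Sum>x\<in>A. card {y \<in> B. R x y}) = (\<Sum>y\<in>B. card {x \<in> A. R x y})"
  using sum.swap_restrict[OF assms, of "\<lambda>_ _. 1::nat" R] by simp

context group
begin

lemma cyclic_subgroups_eq: "cyclic_subgroups G = (\<lambda>x. generate G {x}) ` carrier G"
proof (intro equalityI subsetI)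
  fix H assume "H \<in> cyclic_subgroups G"
  hence H: "subgroup H G" and "cyclic_group (G\<lparr>carrier := H\<rparr>)" by (auto simp: cyclic_subgroups_def)
  then obtain x where x: "x \<in> H" "subgroup_generated (G\<lparr>carrier := H\<rparr>) {x} = G\<lparr>carrier := H\<rparr>"
    by (auto simp: cyclic_group_def)
  hence "carrier (subgroup_generated (G\<lparr>carrier := H\<rparr>) {x}) = carrier (G\<lparr>carrier := H\<rparr>)" by (rule_tac arg_cong)
  hence "generate (G\<lparr>carrier := H\<rparr>) {x} = H" using x(1) by (simp add: carrier_subgroup_generated)
  hence "generate G {x} = H" using generate_consistent[of "{x}" H] x(1) H by simp
  thus "H \<in> (\<lambda>x. generate G {x}) ` carrier G" using x(1) subgroup.subset[OF H] by blast
next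
  fix H assume "H \<in> (\<lambda>x. generate G {x}) ` carrier G"
  then obtain x where x: "x \<in> carrier G" "H = generate G {x}" by blast
  have "cyclic_group (subgroup_generated G {x})" by (rule cyclic_group_generated)
  hence "cyclic_group (G\<lparr>carrier := H\<rparr>)" using x by (simp add: subgroup_generated_def)
  thus "H \<in> cyclic_subgroups G" using x generate_is_subgroup[of "{x}"] by (simp add: cyclic_subgroups_def)
qed

lemma cyclic_group_if_ord_eq_order:
  assumes "finite (carrier G)" "x \<in> carrier G" "ord x = order G"
  shows "cyclic_group G"
proof -
  have "generate G {x} \<subseteq> carrier G" using assms(2) by (simp add: generate_incl)
  moreover have "card (generate G {x}) = card (carrier G)"
    using assms generate_pow_card by (simp add: order_def)
  ultimately have "generate G {x} = carrier G" using card_subset_eq assms(1) by blast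
  hence "subgroup_generated G {x} = G" using assms(2) by (simp add: subgroup_generated_def)
  thus ?thesis using assms(2) by (auto simp: cyclic_group_def)
qed

lemma cyclic_group_ex_ord_eq_order:
  assumes "cyclic_group G"
  obtains x where "x \<in> carrier G" "ord x = order G"
  using assms cyclic_order_is_ord by (metis cyclic_group_def)

text \<open>By Burnside, \<open>\<phi>(n) \<cdot> cyc G\<close> is the total number of fixed points of the power maps
  \<open>x \<mapsto> x\<^sup>k\<close> with \<open>k\<close> coprime to \<open>n\<close>; by Frobenius, there are at least as many as in the cyclic group
  of order \<open>n\<close>.\<close>

theorem card_divisors_le_cyc:
  assumes fin: "finite (carrier G)"
  shows "card {d. d dvd order G} \<le> cyc G"
proof -
  define n where "n = order G"
  define T where "T d = {k \<in> totatives n. [k = 1] (mod d)}" for d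
  have n: "n > 0" using order_gt_0_iff_finite fin by (simp add: n_def)
  have finD: "finite {d. d dvd n}" using n by simp
  have T: "totient d * card (T d) = totient n" if "d dvd n" for d
    unfolding T_def using that n by (rule card_totatives_cong)
  have "totient n * card {d. d dvd n} = (\<Sum>d | d dvd n. totient d * card (T d))"
    using T by simp
  also have "\<dots> = (\<Sum>d | d dvd n. \<Sum>k | k \<in> totatives n \<and> d dvd k - 1. totient d)"
  proof (intro sum.cong refl)
    fix d
    have "T d = {k \<in> totatives n. d dvd k - 1}"
      unfolding T_def using cong_one_iff_dvd_diff by (auto simp: totatives_def)
    thus "totient d * card (T d) = (\<Sum>k | k \<in> totatives n \<and> d dvd k - 1. totient d)" by simp
  qed
  also have "\<dots> = (\<Sum>k\<in>totatives n. \<Sum>d | d \<in> {d. d dvd n} \<and> d dvd k - 1. totient d)"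
    by (rule sum.swap_restrict) (use finD in auto)
  also have "\<dots> = (\<Sum>k\<in>totatives n. gcd (k - 1) n)"
  proof (intro sum.cong refl)
    fix k
    have "{d \<in> {d. d dvd n}. d dvd k - 1} = {d. d dvd gcd (k - 1) n}" by auto
    thus "(\<Sum>d | d \<in> {d. d dvd n} \<and> d dvd k - 1. totient d) = gcd (k - 1) n"
      using totient_divisor_sum[of "gcd (k - 1) n"] by simp
  qed
  also have "\<dots> \<le> (\<Sum>k\<in>totatives n. card (roots_of_one G (k - 1)))"
  proof (rule sum_mono)
    fix k
    have "gcd (k - 1) n dvd card (roots_of_one G (gcd (k - 1) n))"
      using is_group fin by (rule frobenius_dvd_card_roots) (simp add: n_def)
    hence "gcd (k - 1) n dvd card (roots_of_one G (k - 1))"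
      by (simp add: n_def roots_of_one_gcd)
    moreover have "finite (roots_of_one G (k - 1))"
      using fin by (simp add: roots_of_one_def)
    hence "card (roots_of_one G (k - 1)) > 0"
      using one_in_roots_of_one card_gt_0_iff by blast
    ultimately show "gcd (k - 1) n \<le> card (roots_of_one G (k - 1))" by (rule dvd_imp_le)
  qed
  also have "\<dots> = (\<Sum>k\<in>totatives n. card {x \<in> carrier G. [k = 1] (mod ord x)})"
    using cong_one_iff_dvd_diff
    by (intro sum.cong refl arg_cong[where f = card]) (auto simp: roots_of_one_iff totatives_def)
  also have "\<dots> = (\<Sum>x\<in>carrier G. card (T (ord x)))"
    unfolding T_def by (rule sum_card_swap) (use fin in simp_all)
  also have "\<dots> = (\<Sum>C\<in>cyclic_subgroups G. \<Sum>x | x \<in> carrier G \<and> generate G {x} = C. card (T (ord x)))"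
    unfolding cyclic_subgroups_eq by (rule sum.image_gen[OF fin])
  also have "\<dots> = (\<Sum>C\<in>cyclic_subgroups G. totient n)"
  proof (intro sum.cong refl)
    fix C assume "C \<in> cyclic_subgroups G"
    then obtain y where y: "y \<in> carrier G" "C = generate G {y}" by (auto simp: cyclic_subgroups_eq)
    have "(\<Sum>x | x \<in> carrier G \<and> generate G {x} = C. card (T (ord x))) =
        (\<Sum>x | x \<in> carrier G \<and> generate G {x} = C. card (T (ord y)))"
      using y generate_pow_card by (intro sum.cong refl) auto
    also have "\<dots> = totient (ord y) * card (T (ord y))"
      using card_generators[OF fin y(1)] y(2) by simp
    also have "\<dots> = totient n" using T ord_dvd_group_order[OF y(1)] by (simp add: n_def)
    finally show "(\<Sum>x | x \<in> carrier G \<and> generate G {x} = C. card (T (ord x))) = totient n" .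
  qed
  also have "\<dots> = totient n * cyc G" by (simp add: cyc_def)
  finally show ?thesis using n by (simp add: n_def)
qed

lemma cyc_le_card_divisors:
  assumes fin: "finite (carrier G)" and cyc: "cyclic_group G"
  shows "cyc G \<le> card {d. d dvd order G}"
  unfolding cyc_def
proof (rule card_inj_on_le)
  have pos: "order G > 0" using order_gt_0_iff_finite fin by blast
  obtain g where g: "g \<in> carrier G" "ord g = order G" using cyclic_group_ex_ord_eq_order[OF cyc] .
  have eq: "generate G {x} = generate G {g [^] (order G div ord x)}" if x: "x \<in> carrier G" for x
  proof -
    define d where "d = order G div ord x"
    have od: "ord x dvd order G" by (rule ord_dvd_group_order[OF x])
    have "generate G {g} = carrier G"
      using g generate_pow_card fin by (intro card_subset_eq) (auto simp: order_def generate_incl)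
    then obtain k :: nat where k: "x = g [^] k"
      using x generate_pow_on_finite_carrier[OF fin g(1)] by auto
    have "g [^] (k * ord x) = \<one>" using x g(1) by (simp add: k flip: nat_pow_pow)
    hence "d * ord x dvd k * ord x" using g od by (simp add: d_def pow_eq_id)
    moreover have "ord x > 0" using ord_ge_1[OF fin x] by simp
    ultimately have "d dvd k" by simp
    then obtain c where "k = d * c" ..
    hence x_eq: "x = (g [^] d) [^] c" using k g(1) by (simp add: nat_pow_pow)
    have "x \<in> generate G {g [^] d}"
      unfolding x_eq using generate_pow_on_finite_carrier[OF fin] g(1) by auto
    hence "generate G {x} \<subseteq> generate G {g [^] d}"
      using g(1) by (intro generate_subgroup_incl generate_is_subgroup) auto
    moreover have "ord (g [^] d) = ord x"
      using od pos g by (subst ord_pow) (auto simp: d_def dvd_div_eq_0_iff)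
    ultimately show ?thesis
      using x g(1) generate_pow_card fin generate_incl[of "{g [^] d}"]
      unfolding d_def[symmetric] by (intro card_subset_eq) (auto intro: finite_subset)
  qed
  show "inj_on card (cyclic_subgroups G)"
    unfolding cyclic_subgroups_eq
    using eq generate_pow_card by (auto simp: inj_on_def) metis+
  show "card ` cyclic_subgroups G \<subseteq> {d. d dvd order G}"
    using ord_dvd_group_order generate_pow_card by (auto simp: cyclic_subgroups_eq)
  show "finite {d. d dvd order G}" using pos by simp
qed

end

lemma card_divisors_mult_coprime:
  fixes a b :: nat
  assumes "coprime a b"
  shows "card {d. d dvd a * b} = card {d. d dvd a} * card {d. d dvd b}"
proof -
  have "bij_betw (\<lambda>(x, y). x * y) ({d. d dvd a} \<times> {d. d dvd b}) {d. d dvd a * b}"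
    unfolding bij_betw_def
  proof
    have "gcd (x * y) a = x \<and> gcd (x * y) b = y" if "x dvd a" "y dvd b" for x y
    proof -
      have "coprime a y" "coprime b x"
        using assms that coprime_divisors[of a a y b] coprime_divisors[of b b x a]
        by (simp_all add: coprime_commute)
      hence "gcd (x * y) a = gcd x a" "gcd (x * y) b = gcd y b"
        by (simp_all add: gcd_mult_left_right_cancel gcd_mult_left_left_cancel)
      thus ?thesis using that by (simp add: gcd_nat.absorb1)
    qed
    thus "inj_on (\<lambda>(x, y). x * y) ({d. d dvd a} \<times> {d. d dvd b})"
      by (intro inj_onI) (metis (no_types, lifting) SigmaE mem_Collect_eq case_prod_conv)
    show "(\<lambda>(x, y). x * y) ` ({d. d dvd a} \<times> {d. d dvd b}) = {d. d dvd a * b}"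
      using division_decomp[of _ a b] by (auto intro: mult_dvd_mono)
  qed
  hence "card ({d. d dvd a} \<times> {d. d dvd b}) = card {d. d dvd a * b}" by (rule bij_betw_same_card)
  thus ?thesis by (simp add: card_cartesian_product)
qed

lemma card_divisors_prime_power:
  fixes p :: nat
  assumes "prime p"
  shows "card {d. d dvd p ^ k} = Suc k"
proof -
  have "{d. d dvd p ^ k} = (\<lambda>i. p ^ i) ` {..k}"
    using divides_primepow_nat[OF assms] by auto
  moreover have "inj_on (\<lambda>i. p ^ i) {..k}"
    using assms prime_gt_1_nat by (auto simp: inj_on_def)
  ultimately show ?thesis by (simp add: card_image)
qed

lemma card_divisors_bounds:
  fixes n :: nat
  assumes "n > 0"
  shows "(squarefree n \<longrightarrow> card {d. d dvd n} = 2 ^ card {p. prime p \<and> p dvd n}) \<and>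
    (\<not> squarefree n \<longrightarrow> 3 * 2 ^ card {p. prime p \<and> p dvd n} \<le> 2 * card {d. d dvd n})"
  using assms
proof (induction n rule: less_induct)
  case (less n)
  show ?case
  proof (cases "n = 1")
    case True
    have "{p. prime p \<and> p dvd n} = {}" "{d. d dvd n} = {1}"
      using True not_prime_1 by auto
    thus ?thesis using True by (simp only: card.empty card.insert squarefree_1) simp
  next
    case False
    then obtain p where p: "prime p" "p dvd n" using prime_factor_nat by blast
    define k where "k = multiplicity p n"
    obtain m where m: "n = p ^ k * m" "\<not> p dvd m"
      using multiplicity_decompose'[of n p] p(1) less.prems not_prime_unit unfolding k_def
      by (metis less_irrefl)
    have k: "k > 0" using p less.prems by (simp add: k_def prime_multiplicity_gt_zero_iff)
    have m0: "m > 0" using m less.prems by (cases "m = 0") auto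
    have "p ^ k > 1" using one_less_power[OF prime_gt_1_nat[OF p(1)] k] .
    hence "m < n" using m m0 by simp
    note IH = less.IH[OF this m0]
    have cop: "coprime (p ^ k) m" using m(2) p(1) by (simp add: prime_imp_coprime)
    have d: "card {d. d dvd n} = Suc k * card {d. d dvd m}"
      unfolding m(1) card_divisors_mult_coprime[OF cop] card_divisors_prime_power[OF p(1)] ..
    have "{q. prime q \<and> q dvd n} = insert p {q. prime q \<and> q dvd m}"
    proof (intro equalityI subsetI)
      fix q assume "q \<in> {q. prime q \<and> q dvd n}"
      hence q: "prime q" "q dvd p ^ k \<or> q dvd m" using m(1) by (auto simp: prime_dvd_mult_iff)
      have "q = p" if "q dvd p ^ k"
        using that q(1) p(1) prime_dvd_power primes_dvd_imp_eq by blast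
      thus "q \<in> insert p {q. prime q \<and> q dvd m}" using q by blast
    qed (use m p in auto)
    moreover have "finite {q. prime q \<and> q dvd m}" using m0 by (auto intro: finite_subset[of _ "{d. d dvd m}"])
    ultimately have r: "card {q. prime q \<and> q dvd n} = Suc (card {q. prime q \<and> q dvd m})"
      using m(2) by simp
    have m_le: "2 ^ card {q. prime q \<and> q dvd m} \<le> card {d. d dvd m}"
      using IH by (cases "squarefree m") auto
    have sq: "squarefree n \<longleftrightarrow> k = 1 \<and> squarefree m"
    proof
      assume "squarefree n"
      hence "squarefree (p ^ k)" "squarefree m" unfolding m(1) by (rule squarefree_multD)+
      thus "k = 1 \<and> squarefree m" using k p(1) not_prime_unit by (auto simp: squarefree_power_iff)
    next
      assume "k = 1 \<and> squarefree m"
      thus "squarefree n" unfolding m(1)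
        using cop p(1) by (intro squarefree_mult_coprime) (auto simp: squarefree_prime)
    qed
    show ?thesis
    proof (cases "k = 1")
      case True
      thus ?thesis using IH d r sq by auto
    next
      case False
      hence "3 * card {d. d dvd m} \<le> card {d. d dvd n}" unfolding d using k by (intro mult_right_mono) auto
      thus ?thesis using False sq r m_le by auto
    qed
  qed
qed

section \<open>Normal subgroups of prime order\<close>

context group
begin

lemma cauchy_prime:
  assumes "finite (carrier G)" "prime p" "p dvd order G"
  obtains x where "x \<in> carrier G" "ord x = p"
proof -
  from assms(3) obtain m where "order G = p ^ 1 * m" by auto
  then obtain K where K: "subgroup K G" "card K = p ^ 1"
    using sylow_thm[OF assms(2) is_group _ assms(1)] by blast
  have "K \<noteq> {\<one>}" using K(2) assms(2) not_prime_1 by auto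
  then obtain x where x: "x \<in> K" "x \<noteq> \<one>"
    using subgroup.one_closed[OF K(1)] by blast
  have xG: "x \<in> carrier G" using x(1) subgroup.subset[OF K(1)] by blast
  have "ord x dvd p" using subgroup_pow_card[OF K(1) x(1)] K(2) xG by (simp add: pow_eq_id)
  moreover have "ord x \<noteq> 1" using x xG ord_eq_1 by blast
  ultimately have "ord x = p" using assms(2) prime_nat_iff by blast
  thus thesis using that xG by blast
qed

text \<open>The orders of the elements counted by \<open>|roots (p d)| - |roots d| = d (p - k)\<close> are multiples of
  \<open>p\<close>, so \<open>p - 1\<close> divides \<open>d (p - k)\<close>, whence \<open>k = 1\<close>.\<close>

lemma card_roots_of_one_upper:
  assumes fin: "finite (carrier G)" and sq: "squarefree (order G)"
    and d: "d dvd order G"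
    and upper: "\<And>p r. prime p \<Longrightarrow> prime r \<Longrightarrow> p dvd order G div d \<Longrightarrow> r dvd d \<Longrightarrow> p < r"
  shows "card (roots_of_one G d) = d"
  using d upper
proof (induction "order G div d" arbitrary: d rule: less_induct)
  case (less d)
  let ?n = "order G"
  have pos: "?n > 0" using order_gt_0_iff_finite fin by blast
  have d0: "d > 0" using less.prems(1) pos by (rule dvd_pos_nat[rotated])
  show ?case
  proof (cases "d = ?n")
    case True
    have "roots_of_one G d = carrier G" using True ord_dvd_group_order by (auto simp: roots_of_one_iff)
    thus ?thesis using True by (simp add: order_def)
  next
    case False
    define P where "P = {p. prime p \<and> p dvd ?n div d}"
    have nd: "?n div d * d = ?n" using less.prems(1) by simp
    have nd0: "?n div d > 0" using nd pos by (cases "?n div d = 0") auto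
    have "?n div d \<noteq> 1" using nd False by auto
    hence "P \<noteq> {}" unfolding P_def using prime_factor_nat by blast
    moreover have "finite P" unfolding P_def
      using nd0 by (auto intro: finite_subset[of _ "{k. k dvd ?n div d}"])
    ultimately have pP: "Max P \<in> P" and pMax: "\<And>r. r \<in> P \<Longrightarrow> r \<le> Max P" by auto
    define p where "p = Max P"
    have p: "prime p" "p dvd ?n div d" using pP by (auto simp: P_def p_def)
    obtain e where e: "?n div d = p * e" using p(2) by blast
    have n_eq: "?n = p * d * e" using nd e by (metis mult.assoc mult.commute)
    have p0: "p > 0" using p(1) prime_gt_0_nat by blast
    have e0: "e > 0" using n_eq pos by (cases "e = 0") auto
    have nd': "?n div (p * d) = e" unfolding n_eq using p0 d0 by simp
    have not_sq: "\<not> p * p dvd ?n"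
      using sq p(1) squarefreeD[of ?n p] not_prime_unit by (auto simp: power2_eq_square)
    have pe: "\<not> p dvd e"
    proof
      assume "p dvd e"
      hence "p * p dvd p * d * e" by (metis dvd_mult mult.assoc mult.commute mult_dvd_mono dvd_refl)
      thus False using not_sq n_eq by simp
    qed
    have pd: "\<not> p dvd d"
    proof
      assume "p dvd d"
      hence "p * p dvd p * d * e" by (intro dvd_mult2 mult_dvd_mono) auto
      thus False using not_sq n_eq by simp
    qed
    have "e < p * e" using p(1) e0 prime_gt_1_nat by simp
    hence lt: "?n div (p * d) < ?n div d" unfolding nd' e .
    have card_pd: "card (roots_of_one G (p * d)) = p * d"
    proof (rule less.hyps[OF lt])
      show "p * d dvd ?n" unfolding n_eq by simp
      fix s r assume sr: "prime s" "prime r" "s dvd ?n div (p * d)" "r dvd p * d"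
      have se: "s dvd e" using sr(3) nd' by simp
      hence s_nd: "s dvd ?n div d" using e by simp
      have "s \<le> p" using pMax s_nd sr(1) by (simp add: P_def p_def)
      moreover have "s \<noteq> p" using se pe by blast
      ultimately have "s < p" by simp
      from sr(2,4) consider "r dvd p" | "r dvd d" by (auto simp: prime_dvd_mult_iff)
      thus "s < r"
      proof cases
        case 1
        hence "r = p" using sr(2) p(1) primes_dvd_imp_eq by blast
        thus ?thesis using \<open>s < p\<close> by simp
      next
        case 2
        thus ?thesis using less.prems(2) sr(1,2) s_nd by blast
      qed
    qed
    have "d dvd card (roots_of_one G d)" using is_group fin less.prems(1) by (rule frobenius_dvd_card_roots)
    then obtain k where k: "card (roots_of_one G d) = d * k" by blast
    have fin_roots: "finite (roots_of_one G j)" for j using fin by (simp add: roots_of_one_def)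
    have "card (roots_of_one G d) > 0" using one_in_roots_of_one fin_roots card_gt_0_iff by blast
    hence k0: "k > 0" using k by (cases "k = 0") auto
    have sub: "roots_of_one G d \<subseteq> roots_of_one G (p * d)" by (auto simp: roots_of_one_iff)
    define S where "S = roots_of_one G (p * d) - roots_of_one G d"
    have card_S: "card S = d * (p - k)"
      unfolding S_def card_Diff_subset[OF fin_roots sub] card_pd k by (simp add: diff_mult_distrib2 mult.commute)
    obtain x where x: "x \<in> carrier G" "ord x = p" using cauchy_prime[OF fin p(1)] n_eq by auto
    hence "x \<in> S" using pd by (simp add: S_def roots_of_one_iff)
    hence "card S > 0" using fin_roots by (auto simp: S_def card_gt_0_iff)
    hence kp: "k < p" using card_S by (cases "p - k = 0") auto
    have "p - 1 dvd card {x \<in> carrier G. ord x dvd p * d \<and> \<not> ord x dvd d}"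
    proof (rule dvd_card_ord_class[OF fin])
      fix x assume x: "ord x dvd p * d \<and> \<not> ord x dvd d"
      have "p dvd ord x"
      proof (rule ccontr)
        assume "\<not> p dvd ord x"
        hence "coprime (ord x) p" using p(1) by (simp add: prime_imp_coprime coprime_commute)
        thus False using x coprime_dvd_mult_right_iff by blast
      qed
      hence "totient p dvd totient (ord x)" by (rule totient_dvd)
      thus "p - 1 dvd totient (ord x)" using p(1) by (simp add: totient_prime)
    qed
    also have "{x \<in> carrier G. ord x dvd p * d \<and> \<not> ord x dvd d} = S"
      by (auto simp: S_def roots_of_one_iff)
    finally have dvd: "p - 1 dvd d * (p - k)" unfolding card_S .
    have "coprime (p - 1) d"
    proof (rule ccontr)
      assume "\<not> coprime (p - 1) d"
      then obtain r where r: "prime r" "r dvd p - 1" "r dvd d"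
        by (metis coprime_iff_gcd_eq_1 gcd_nat.bounded_iff prime_factor_nat)
      have "p < r" using less.prems(2) p r(1,3) by blast
      moreover have "r \<le> p - 1" using r(2) p(1) prime_gt_1_nat by (intro dvd_imp_le) auto
      ultimately show False by simp
    qed
    hence "p - 1 dvd p - k" using dvd coprime_dvd_mult_right_iff by blast
    hence "p - 1 \<le> p - k" using kp by (intro dvd_imp_le) auto
    hence "k = 1" using k0 kp by simp
    thus ?thesis using k by simp
  qed
qed

lemma squarefree_normal_prime_subgroup:
  assumes fin: "finite (carrier G)" and sq: "squarefree (order G)" and "order G \<noteq> 1"
  obtains N q where "N \<lhd> G" "prime q" "card N = q"
proof -
  let ?n = "order G"
  define P where "P = {p. prime p \<and> p dvd ?n}"
  have pos: "?n > 0" using order_gt_0_iff_finite fin by blast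
  have "P \<noteq> {}" unfolding P_def using prime_factor_nat assms(3) by blast
  moreover have "finite P" unfolding P_def using pos by (auto intro: finite_subset[of _ "{k. k dvd ?n}"])
  ultimately have "Max P \<in> P" and qMax: "\<And>r. r \<in> P \<Longrightarrow> r \<le> Max P" by auto
  define q where "q = Max P"
  have q: "prime q" "q dvd ?n" using \<open>Max P \<in> P\<close> by (auto simp: P_def q_def)
  have card_N: "card (roots_of_one G q) = q"
  proof (rule card_roots_of_one_upper[OF fin sq q(2)])
    fix p r assume pr: "prime p" "prime r" "p dvd ?n div q" "r dvd q"
    have "r = q" using pr(2,4) q(1) primes_dvd_imp_eq by blast
    have "p * q dvd ?n" using pr(3) q(2) by (metis dvd_div_mult_self dvd_refl mult_dvd_mono)
    moreover have "\<not> q * q dvd ?n"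
      using sq q(1) squarefreeD[of ?n q] not_prime_unit by (auto simp: power2_eq_square)
    ultimately have "p \<noteq> q" "p dvd ?n" by (auto dest: dvd_mult_left)
    thus "p < r" using qMax[of p] pr(1) unfolding \<open>r = q\<close> by (simp add: P_def q_def)
  qed
  obtain y where y: "y \<in> carrier G" "ord y = q" using cauchy_prime[OF fin q] .
  have "generate G {y} \<subseteq> roots_of_one G q"
    using y by (auto simp: generate_pow_on_finite_carrier[OF fin] roots_of_one_def nat_pow_pow pow_eq_id)
  moreover have "card (generate G {y}) = card (roots_of_one G q)" using generate_pow_card y card_N by simp
  moreover have "finite (roots_of_one G q)" using fin by (simp add: roots_of_one_def)
  ultimately have eq: "roots_of_one G q = generate G {y}" using card_subset_eq by blast
  have "roots_of_one G q \<lhd> G"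
    unfolding normal_inv_iff
  proof (intro conjI ballI)
    show "subgroup (roots_of_one G q) G" unfolding eq using y generate_is_subgroup by simp
  qed (auto simp: roots_of_one_def conj_pow)
  thus thesis using that q(1) card_N by blast
qed

end

section \<open>Lifting cyclic subgroups from a quotient\<close>

lemma (in group) cyclic_subgroups_finite: "finite (carrier G) \<Longrightarrow> finite (cyclic_subgroups G)"
  by (simp add: cyclic_subgroups_eq)

lemma (in group) subgroup_nat_pow_closed:
  assumes "subgroup K G" "x \<in> K"
  shows "x [^] (n::nat) \<in> K"
proof (induction n)
  case 0
  show ?case using subgroup.one_closed[OF assms(1)] by simp
next
  case (Suc n)
  thus ?case using assms by (simp add: subgroup.m_closed)
qed

locale prime_kernel_hom = group_hom +
  fixes q :: nat
  assumes fin: "finite (carrier G)"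
    and surj: "h ` carrier G = carrier H"
    and q: "prime q" "card (kernel G H h) = q"
    and cop: "coprime (order H) q"
begin

abbreviation "K \<equiv> kernel G H h"

lemma K_iff: "x \<in> K \<longleftrightarrow> x \<in> carrier G \<and> h x = \<one>\<^bsub>H\<^esub>"
  by (simp add: kernel_def)

lemma finite_H: "finite (carrier H)"
  using fin surj by (metis finite_imageI)

lemma order_G: "order G = order H * q"
  using order_kernel[OF surj] q(2) by simp

lemma K_pow: "x \<in> K \<Longrightarrow> x [^] q = \<one>"
  using G.subgroup_pow_card[OF subgroup_kernel] q(2) by simp

lemma ord_K:
  assumes "x \<in> K" "x \<noteq> \<one>"
  shows "G.ord x = q"
proof -
  have x: "x \<in> carrier G" using assms(1) K_iff by blast
  have "G.ord x dvd q" using K_pow[OF assms(1)] x by (simp add: G.pow_eq_id)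
  moreover have "G.ord x \<noteq> 1" using assms(2) x G.ord_eq_1 by blast
  ultimately show ?thesis using q(1) prime_nat_iff by blast
qed

lemma K_generate:
  assumes "x \<in> K" "x \<noteq> \<one>"
  shows "generate G {x} = K"
proof -
  have x: "x \<in> carrier G" using assms(1) K_iff by blast
  have "finite K" using fin K_iff by (auto intro: finite_subset)
  moreover have "generate G {x} \<subseteq> K"
    using assms(1) by (intro G.generate_subgroup_incl subgroup_kernel) simp
  moreover have "card (generate G {x}) = card K"
    using G.generate_pow_card[OF x] ord_K[OF assms] q(2) by simp
  ultimately show ?thesis by (rule card_subset_eq)
qed

lemma ex_K: obtains y where "y \<in> K" "y \<noteq> \<one>"
proof -
  have "K \<noteq> {\<one>}" using q not_prime_1 by auto
  thus thesis using that subgroup.one_closed[OF subgroup_kernel] by blast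
qed

lemma commute_K:
  assumes g: "g \<in> carrier G" and x: "x \<in> K" "x \<noteq> \<one>" "x \<otimes> g = g \<otimes> x" and y: "y \<in> K"
  shows "y \<otimes> g = g \<otimes> y"
proof -
  have xG: "x \<in> carrier G" using x(1) K_iff by blast
  have "y \<in> generate G {x}" using K_generate[OF x(1,2)] y by simp
  then obtain k :: nat where k: "y = x [^] k"
    unfolding G.generate_pow_on_finite_carrier[OF fin xG] by blast
  show ?thesis unfolding k by (rule G.group_commutes_pow[OF x(3) xG g])
qed

lemma lift:
  assumes "x \<in> carrier H"
  obtains g where "g \<in> carrier G" "h g = x" "coprime (G.ord g) q"
proof -
  have "x \<in> h ` carrier G" using assms surj by simp
  then obtain g where g: "g \<in> carrier G" "h g = x" by blast
  obtain j where j: "[j = 1] (mod order H)" "[j = 0] (mod q)"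
    using binary_chinese_remainder_nat[OF cop] by blast
  have "[j = 1] (mod H.ord x)" using j(1) H.ord_dvd_group_order[OF assms] cong_dvd_modulus_nat by blast
  hence "x [^]\<^bsub>H\<^esub> j = x [^]\<^bsub>H\<^esub> (1::nat)" by (rule H.nat_pow_cong[OF assms])
  hence "h (g [^] j) = x" using g assms by (simp add: hom_nat_pow)
  moreover have "G.ord (g [^] j) dvd order H"
  proof -
    obtain c where "j = q * c" using j(2) by (auto simp: cong_0_iff)
    hence "order G dvd j * order H" by (simp add: order_G mult_ac)
    hence "G.ord g dvd j * order H" using G.ord_dvd_group_order[OF g(1)] dvd_trans by blast
    hence "(g [^] j) [^] order H = \<one>" using g(1) by (simp add: G.nat_pow_pow G.pow_eq_id)
    thus ?thesis using g(1) by (simp add: G.pow_eq_id)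
  qed
  from coprime_divisors[OF this dvd_refl cop] have "coprime (G.ord (g [^] j)) q" .
  ultimately show thesis using that g(1) by blast
qed

lemma ord_image:
  assumes g: "g \<in> carrier G" and copg: "coprime (G.ord g) q"
  shows "H.ord (h g) = G.ord g"
proof (rule dvd_antisym)
  have "h g [^]\<^bsub>H\<^esub> G.ord g = \<one>\<^bsub>H\<^esub>"
    using hom_nat_pow[OF g, of "G.ord g"] g by simp
  thus "H.ord (h g) dvd G.ord g" using g by (simp add: H.pow_eq_id)
  define n where "n = H.ord (h g)"
  have "h (g [^] n) = \<one>\<^bsub>H\<^esub>" using g by (simp add: hom_nat_pow n_def)
  hence "g [^] n \<in> K" using g by (simp add: K_iff)
  hence "(g [^] n) [^] q = \<one>" by (rule K_pow)
  hence "G.ord g dvd n * q" using g by (simp add: G.nat_pow_pow G.pow_eq_id)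
  thus "G.ord g dvd H.ord (h g)" using copg coprime_dvd_mult_left_iff unfolding n_def by blast
qed

definition fiber :: "'c set \<Rightarrow> 'a set set" where
  "fiber D = {C \<in> cyclic_subgroups G. h ` C = D}"

lemma finite_fiber: "finite (fiber D)"
  using G.cyclic_subgroups_finite[OF fin] by (simp add: fiber_def)

lemma generate_in_fiber:
  assumes "x \<in> carrier G" "h x = h g"
  shows "generate G {x} \<in> fiber (generate H {h g})"
  using assms generate_img[of "{x}"] by (auto simp: fiber_def G.cyclic_subgroups_eq)

lemma two_le_fiber_commuting:
  assumes g: "g \<in> carrier G" "coprime (G.ord g) q" and y: "y \<in> K" "y \<noteq> \<one>" "y \<otimes> g = g \<otimes> y"
  shows "2 \<le> card (fiber (generate H {h g}))"
proof -
  have yG: "y \<in> carrier G" and hy: "h y = \<one>\<^bsub>H\<^esub>" using y(1) K_iff by auto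
  have "(y \<otimes> g) [^] G.ord g = y [^] G.ord g"
    using G.pow_mult_distrib[OF y(3) yG g(1), of "G.ord g"] yG g(1) by simp
  moreover have "y [^] G.ord g \<noteq> \<one>"
  proof
    assume "y [^] G.ord g = \<one>"
    hence "q dvd G.ord g" using yG ord_K[OF y(1,2)] by (simp add: G.pow_eq_id)
    thus False using g(2) q(1) by (meson coprime_common_divisor dvd_refl not_prime_unit)
  qed
  ultimately have "G.ord (y \<otimes> g) \<noteq> G.ord g" using G.pow_ord_eq_1[of "y \<otimes> g"] yG g(1) by (metis G.m_closed)
  hence ne: "generate G {y \<otimes> g} \<noteq> generate G {g}"
    using G.generate_pow_card yG g(1) by (metis G.m_closed)
  have "{generate G {y \<otimes> g}, generate G {g}} \<subseteq> fiber (generate H {h g})"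
    using yG g(1) hy by (auto intro!: generate_in_fiber)
  from card_mono[OF finite_fiber this] show ?thesis using ne by simp
qed

text \<open>Distinct elements of \<open>K\<close> conjugate \<open>\<langle>g\<rangle>\<close> to distinct subgroups, since an element of \<open>K\<close>
  normalizing \<open>\<langle>g\<rangle>\<close> centralizes it.\<close>

lemma three_le_fiber_noncommuting:
  assumes g: "g \<in> carrier G" "coprime (G.ord g) q" and y: "y \<in> K" "y \<otimes> g \<noteq> g \<otimes> y"
  shows "3 \<le> card (fiber (generate H {h g}))"
proof -
  have yG: "y \<in> carrier G" and hy: "h y = \<one>\<^bsub>H\<^esub>" using y(1) K_iff by auto
  have y1: "y \<noteq> \<one>" using y(2) g(1) by auto
  have finK: "finite K" using fin K_iff by (auto intro: finite_subset)
  have no_comm: "w = \<one>" if "w \<in> K" "w \<otimes> g = g \<otimes> w" for w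
    using commute_K[OF g(1) that(1) _ that(2) y(1)] y(2) by blast
  have normalizes: "w = \<one>" if w: "w \<in> K" "w \<otimes> g \<otimes> inv w \<in> generate G {g}" for w
  proof -
    have wG: "w \<in> carrier G" "h w = \<one>\<^bsub>H\<^esub>" using w(1) K_iff by auto
    obtain k :: nat where k: "w \<otimes> g \<otimes> inv w = g [^] k"
      using w(2) unfolding G.generate_pow_on_finite_carrier[OF fin g(1)] by blast
    have "h (w \<otimes> g \<otimes> inv w) = h g" using wG g(1) by simp
    hence "h g [^]\<^bsub>H\<^esub> int k = h g [^]\<^bsub>H\<^esub> int 1"
      using hom_nat_pow[OF g(1), of k] g(1) by (simp add: k int_pow_int)
    hence "int (G.ord g) dvd int 1 - int k"
      using H.int_pow_eq[of "h g" "int k" "int 1"] ord_image[OF g] g(1) by simp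
    hence "g [^] int k = g [^] int 1" using G.int_pow_eq[OF g(1)] by blast
    hence "g [^] k = g" using g(1) by (simp add: int_pow_int)
    hence "w \<otimes> g = g \<otimes> w" using k G.conj_eq_self_iff[OF wG(1) g(1)] by simp
    thus ?thesis using no_comm w(1) by blast
  qed
  have inj: "inj_on (\<lambda>w. generate G {w \<otimes> g \<otimes> inv w}) K"
  proof (rule inj_onI)
    fix v w assume vw: "v \<in> K" "w \<in> K" "generate G {v \<otimes> g \<otimes> inv v} = generate G {w \<otimes> g \<otimes> inv w}"
    have G: "v \<in> carrier G" "w \<in> carrier G" using vw(1,2) K_iff by auto
    have "v \<otimes> g \<otimes> inv v \<in> generate G {w \<otimes> g \<otimes> inv w}"
      unfolding vw(3)[symmetric] by (rule generate.incl) simp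
    moreover have "w \<otimes> g \<otimes> inv w \<in> carrier G" using G g(1) by simp
    ultimately obtain k :: nat where k: "v \<otimes> g \<otimes> inv v = (w \<otimes> g \<otimes> inv w) [^] k"
      using G.generate_pow_on_finite_carrier[OF fin] by blast
    have "v \<otimes> g \<otimes> inv v = w \<otimes> g [^] k \<otimes> inv w" unfolding k using G g(1) by (simp add: G.conj_pow)
    hence "inv w \<otimes> (v \<otimes> g \<otimes> inv v) \<otimes> w = inv w \<otimes> (w \<otimes> g [^] k \<otimes> inv w) \<otimes> w" by simp
    also have "\<dots> = g [^] k"
    proof -
      have "inv w \<otimes> (w \<otimes> g [^] k) = g [^] k" using G g(1) G.m_assoc[of "inv w" w "g [^] k"] by simp
      thus ?thesis using G g(1) by (simp add: G.m_assoc)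
    qed
    also have "inv w \<otimes> (v \<otimes> g \<otimes> inv v) \<otimes> w = (inv w \<otimes> v) \<otimes> g \<otimes> inv (inv w \<otimes> v)"
      using G g(1) by (simp add: G.m_assoc G.inv_mult_group)
    finally have "(inv w \<otimes> v) \<otimes> g \<otimes> inv (inv w \<otimes> v) \<in> generate G {g}"
      using G.generate_pow_on_finite_carrier[OF fin g(1)] by blast
    moreover have "inv w \<otimes> v \<in> K"
      using vw(1,2) subgroup_kernel by (simp add: subgroup.m_closed subgroup.m_inv_closed)
    ultimately have "inv w \<otimes> v = \<one>" using normalizes by blast
    thus "v = w" using G by (metis G.inv_closed G.inv_equality G.inv_inv)
  qed
  have "3 \<le> card K"
  proof -
    define z where "z = g \<otimes> y \<otimes> inv g"
    have "z \<in> K" using g(1) yG hy by (simp add: z_def K_iff)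
    moreover have "z \<noteq> y" using y(2) G.conj_eq_self_iff[OF g(1) yG] by (auto simp: z_def)
    moreover have "z \<noteq> \<one>"
    proof
      assume "z = \<one>"
      hence "g \<otimes> y = \<one> \<otimes> g" using g(1) yG unfolding z_def by (metis G.inv_solve_right G.m_closed G.one_closed)
      thus False using g(1) yG y1 by simp
    qed
    ultimately have "card {\<one>, y, z} = 3" "{\<one>, y, z} \<subseteq> K"
      using y1 y(1) subgroup.one_closed[OF subgroup_kernel] by auto
    thus ?thesis using card_mono[OF finK] by metis
  qed
  also have "card K = card ((\<lambda>w. generate G {w \<otimes> g \<otimes> inv w}) ` K)" using inj by (simp add: card_image)
  also have "\<dots> \<le> card (fiber (generate H {h g}))"
  proof (intro card_mono finite_fiber image_subsetI)
    fix w assume "w \<in> K"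
    hence "w \<in> carrier G" "h w = \<one>\<^bsub>H\<^esub>" using K_iff by auto
    thus "generate G {w \<otimes> g \<otimes> inv w} \<in> fiber (generate H {h g})"
      using g(1) by (intro generate_in_fiber) simp_all
  qed
  finally show ?thesis .
qed

lemma two_le_fiber:
  assumes "D \<in> cyclic_subgroups H"
  shows "2 \<le> card (fiber D)"
proof -
  obtain x where x: "x \<in> carrier H" "D = generate H {x}" using assms by (auto simp: H.cyclic_subgroups_eq)
  obtain g where g: "g \<in> carrier G" "h g = x" "coprime (G.ord g) q" using lift[OF x(1)] .
  obtain y where y: "y \<in> K" "y \<noteq> \<one>" by (rule ex_K)
  show ?thesis
    using two_le_fiber_commuting[OF g(1,3) y] three_le_fiber_noncommuting[OF g(1,3) y(1)]
    by (cases "y \<otimes> g = g \<otimes> y") (auto simp: x(2) g(2))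
qed

lemma sum_fiber_le_cyc: "(\<Sum>D\<in>cyclic_subgroups H. card (fiber D)) \<le> cyc G"
proof -
  have "(\<Sum>D\<in>cyclic_subgroups H. card (fiber D)) = card (\<Union>D\<in>cyclic_subgroups H. fiber D)"
    using H.cyclic_subgroups_finite[OF finite_H] finite_fiber
    by (intro card_UN_disjoint[symmetric]) (auto simp: fiber_def)
  also have "\<dots> \<le> cyc G"
    unfolding cyc_def using G.cyclic_subgroups_finite[OF fin]
    by (intro card_mono) (auto simp: fiber_def)
  finally show ?thesis .
qed

lemma two_cyc_le: "2 * cyc H \<le> cyc G"
proof -
  have "2 * cyc H = (\<Sum>D\<in>cyclic_subgroups H. 2)" by (simp add: cyc_def)
  also have "\<dots> \<le> (\<Sum>D\<in>cyclic_subgroups H. card (fiber D))" by (intro sum_mono two_le_fiber)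
  finally show ?thesis using sum_fiber_le_cyc by simp
qed

lemma cyclic_group_if_commuting:
  assumes g: "g \<in> carrier G" "coprime (G.ord g) q" "H.ord (h g) = order H"
    and y: "y \<in> K" "y \<noteq> \<one>" "y \<otimes> g = g \<otimes> y"
  shows "cyclic_group G"
proof (rule G.cyclic_group_if_ord_eq_order[OF fin])
  have yG: "y \<in> carrier G" and hy: "h y = \<one>\<^bsub>H\<^esub>" using y(1) K_iff by auto
  show "y \<otimes> g \<in> carrier G" using yG g(1) by simp
  show "G.ord (y \<otimes> g) = order G"
  proof (rule dvd_antisym)
    show "G.ord (y \<otimes> g) dvd order G" by (rule G.ord_dvd_group_order) (use yG g(1) in simp)
    define n where "n = G.ord (y \<otimes> g)"
    have "(y \<otimes> g) [^] n = \<one>" using yG g(1) by (simp add: n_def)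
    hence yg: "y [^] n \<otimes> g [^] n = \<one>" using G.pow_mult_distrib[OF y(3) yG g(1)] by simp
    hence "h (y [^] n \<otimes> g [^] n) = \<one>\<^bsub>H\<^esub>" by simp
    hence "h g [^]\<^bsub>H\<^esub> n = \<one>\<^bsub>H\<^esub>" using yG g(1) hy by (simp add: hom_nat_pow)
    hence m: "order H dvd n" using g by (simp add: H.pow_eq_id)
    hence "g [^] n = \<one>" using g ord_image[OF g(1,2)] by (simp add: G.pow_eq_id)
    hence "y [^] n = \<one>" using yg yG by simp
    hence "q dvd n" using yG ord_K[OF y(1,2)] by (simp add: G.pow_eq_id)
    thus "order G dvd G.ord (y \<otimes> g)" unfolding order_G using m cop divides_mult n_def by blast
  qed
qed

lemma num_prime_divisors_G: "num_prime_divisors G = Suc (num_prime_divisors H)"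
proof -
  have "order H > 0" using H.order_gt_0_iff_finite finite_H by blast
  hence "finite {p. prime p \<and> p dvd order H}" by (auto intro: finite_subset[of _ "{k. k dvd order H}"])
  moreover have "{p. prime p \<and> p dvd order G} = insert q {p. prime p \<and> p dvd order H}"
    unfolding order_G using q(1) primes_dvd_imp_eq[OF _ q(1)] by (auto simp: prime_dvd_mult_iff)
  moreover have "\<not> q dvd order H"
    using cop q(1) by (metis coprime_common_divisor dvd_refl not_prime_unit)
  ultimately show ?thesis by (simp add: num_prime_divisors_def)
qed

text \<open>At least half of the subgroups of \<open>H\<close> are not centralized, namely those whose order is divisible
  by a suitable prime \<open>p\<close>.\<close>

lemma cyc_ge_if_cyclic_quotient:
  assumes cycH: "cyclic_group H" and sq: "squarefree (order H)" and not_cyc: "\<not> cyclic_group G"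
  shows "5 * 2 ^ num_prime_divisors G \<le> 4 * cyc G"
proof -
  define m where "m = order H"
  have m0: "m > 0" unfolding m_def using H.order_gt_0_iff_finite finite_H by blast
  obtain c where c: "c \<in> carrier H" "H.ord c = m"
    unfolding m_def using H.cyclic_group_ex_ord_eq_order[OF cycH] .
  obtain g where g: "g \<in> carrier G" "h g = c" "coprime (G.ord g) q" using lift[OF c(1)] .
  have ord_g: "G.ord g = m" using ord_image[OF g(1,3)] g(2) c(2) by simp
  obtain y where y: "y \<in> K" "y \<noteq> \<one>" by (rule ex_K)
  have yG: "y \<in> carrier G" using y(1) K_iff by blast
  define Z where "Z = G.centralizer y"
  have Z: "subgroup Z G" unfolding Z_def using yG by (rule G.conj_class_centralizer)
  have Z_iff: "x \<in> Z \<longleftrightarrow> x \<in> carrier G \<and> y \<otimes> x = x \<otimes> y" for x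
    by (auto simp: Z_def G.centralizer_def)
  have gZ: "g \<notin> Z"
    using cyclic_group_if_commuting[OF g(1,3) _ y] c(2) g(2) not_cyc by (auto simp: Z_iff m_def)
  define P where "P j \<longleftrightarrow> j > 0 \<and> g [^] j \<in> Z" for j :: nat
  define e where "e = Least P"
  have gm: "g [^] m \<in> Z" using g(1) ord_g subgroup.one_closed[OF Z] by (metis G.pow_ord_eq_1)
  hence "P m" using m0 by (simp add: P_def)
  hence "P e" unfolding e_def by (rule LeastI[of P])
  hence e: "e > 0" "g [^] e \<in> Z" by (simp_all add: P_def)
  have e_dvd: "e dvd j" if j: "g [^] j \<in> Z" for j
  proof -
    define r where "r = j mod e"
    have "(g [^] e) [^] (j div e) \<otimes> g [^] r = g [^] (e * (j div e) + r)"
      using g(1) by (simp add: G.nat_pow_mult G.nat_pow_pow)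
    hence eq: "g [^] j = (g [^] e) [^] (j div e) \<otimes> g [^] r" by (simp add: r_def)
    have w: "(g [^] e) [^] (j div e) \<in> Z" by (rule G.subgroup_nat_pow_closed[OF Z e(2)])
    have wG: "(g [^] e) [^] (j div e) \<in> carrier G" "g [^] r \<in> carrier G" using g(1) by auto
    have "g [^] r = inv ((g [^] e) [^] (j div e)) \<otimes> g [^] j"
      unfolding eq using wG by (simp add: G.m_assoc[symmetric])
    also have "\<dots> \<in> Z" using w j Z by (simp add: subgroup.m_closed subgroup.m_inv_closed)
    finally have "g [^] r \<in> Z" .
    moreover have "r < e" using e(1) by (simp add: r_def)
    hence "\<not> P r" using not_less_Least[of r P] unfolding e_def by blast
    ultimately have "r = 0" by (simp add: P_def)
    thus ?thesis by (simp add: r_def mod_eq_0_iff_dvd)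
  qed
  have "e \<noteq> 1" using gZ e(2) g(1) by auto
  then obtain p where p: "prime p" "p dvd e" using prime_factor_nat by blast
  have "p dvd m" using p(2) e_dvd[OF gm] by (rule dvd_trans)
  then obtain l where l: "m = p * l" by blast
  have pl: "\<not> p dvd l"
  proof
    assume "p dvd l"
    hence "p ^ 2 dvd m" unfolding l by (simp add: power2_eq_square)
    thus False using sq p(1) squarefreeD not_prime_unit unfolding m_def by blast
  qed
  define A where "A = {d. d dvd l}"
  define B where "B = (\<lambda>d. generate H {c [^]\<^bsub>H\<^esub> d}) ` A"
  have l0: "l > 0" using l m0 by (cases "l = 0") auto
  have card_m: "card {d. d dvd m} = 2 * card A"
    unfolding l A_def
    using card_divisors_mult_coprime[of p l] card_divisors_prime_power[OF p(1), of 1] pl p(1)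
    by (simp add: prime_imp_coprime)
  have "inj_on (\<lambda>d. generate H {c [^]\<^bsub>H\<^esub> d}) A"
  proof (rule inj_onI)
    fix d d' assume d: "d \<in> A" "d' \<in> A" "generate H {c [^]\<^bsub>H\<^esub> d} = generate H {c [^]\<^bsub>H\<^esub> d'}"
    have "H.ord (c [^]\<^bsub>H\<^esub> i) = m div i \<and> i dvd m" if "i \<in> A" for i
    proof -
      have "i dvd m" "i \<noteq> 0" using that l l0 by (auto simp: A_def)
      thus ?thesis using H.ord_pow[OF c(1), of i] c(2) by simp
    qed
    moreover have "H.ord (c [^]\<^bsub>H\<^esub> d) = H.ord (c [^]\<^bsub>H\<^esub> d')"
      using d(3) H.generate_pow_card c(1) by simp
    ultimately have "m div d = m div d'" "d dvd m" "d' dvd m" using d(1,2) by auto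
    thus "d = d'" using m0 by (metis dvd_div_eq_0_iff dvd_mult_div_cancel gr_implies_not0 mult_right_cancel)
  qed
  hence card_B: "card B = card A" by (simp add: B_def card_image)
  have B_sub: "B \<subseteq> cyclic_subgroups H" using c(1) by (auto simp: B_def H.cyclic_subgroups_eq)
  have three: "3 \<le> card (fiber D)" if D: "D \<in> B" for D
  proof -
    obtain d where d: "d dvd l" "D = generate H {c [^]\<^bsub>H\<^esub> d}" using D by (auto simp: B_def A_def)
    have "\<not> p dvd d" using pl d(1) dvd_trans by blast
    hence "g [^] d \<notin> Z" using e_dvd p(2) dvd_trans by blast
    hence "y \<otimes> g [^] d \<noteq> g [^] d \<otimes> y" using g(1) by (simp add: Z_iff)
    moreover have "G.ord (g [^] d) dvd G.ord g"
      using g(1) by (simp add: G.nat_pow_pow flip: G.pow_eq_id) (simp add: G.pow_eq_id)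
    from coprime_divisors[OF this dvd_refl g(3)] have "coprime (G.ord (g [^] d)) q" .
    moreover have "h (g [^] d) = c [^]\<^bsub>H\<^esub> d" using g by (simp add: hom_nat_pow)
    ultimately show ?thesis using three_le_fiber_noncommuting[of "g [^] d" y] g(1) y(1) d(2) by simp
  qed
  have finC: "finite (cyclic_subgroups H)" by (rule H.cyclic_subgroups_finite[OF finite_H])
  have "2 * cyc H + card A = (\<Sum>D\<in>cyclic_subgroups H. 2) + (\<Sum>D\<in>B. 1)"
    by (simp add: cyc_def card_B)
  also have "(\<Sum>D\<in>B. 1::nat) = (\<Sum>D\<in>cyclic_subgroups H. if D \<in> B then 1 else 0)"
    using sum.inter_restrict[OF finC, of "\<lambda>_. 1::nat" B] B_sub by (simp add: Int_absorb1)
  also have "(\<Sum>D\<in>cyclic_subgroups H. 2) + \<dots> = (\<Sum>D\<in>cyclic_subgroups H. 2 + (if D \<in> B then 1 else 0))"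
    by (rule sum.distrib[symmetric])
  also have "\<dots> \<le> (\<Sum>D\<in>cyclic_subgroups H. card (fiber D))"
  proof (rule sum_mono)
    fix D assume "D \<in> cyclic_subgroups H"
    thus "2 + (if D \<in> B then 1 else 0) \<le> card (fiber D)"
      using two_le_fiber[of D] three[of D] by (cases "D \<in> B") simp_all
  qed
  also have "\<dots> \<le> cyc G" by (rule sum_fiber_le_cyc)
  finally have "2 * cyc H + card A \<le> cyc G" .
  moreover have "card {d. d dvd m} \<le> cyc H" unfolding m_def by (rule H.card_divisors_le_cyc[OF finite_H])
  moreover have "card {d. d dvd m} = 2 ^ num_prime_divisors H"
    using card_divisors_bounds[OF m0] sq by (simp add: m_def num_prime_divisors_def)
  ultimately show ?thesis using card_m by (simp add: num_prime_divisors_G)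
qed

end

lemma squarefree_cyclic_or_cyc_ge:
  fixes G :: "('a, 'b) monoid_scheme"
  assumes "group G" "finite (carrier G)" "squarefree (order G)"
  shows "cyclic_group G \<or> 5 * 2 ^ num_prime_divisors G \<le> 4 * cyc G"
  using assms
proof (induction "order G" arbitrary: G rule: less_induct)
  case (less G)
  interpret group G by (rule less.prems)
  note fin = less.prems(2) and sq = less.prems(3)
  show ?case
  proof (cases "order G = 1")
    case True
    thus ?thesis using cyclic_group_if_ord_eq_order[OF fin one_closed] by simp
  next
    case False
    obtain N q where N: "N \<lhd> G" "prime q" "card N = q"
      using squarefree_normal_prime_subgroup[OF fin sq False] .
    obtain Q :: "('a, 'b) monoid_scheme" and h
      where Q: "group_hom G Q h" "h ` carrier G = carrier Q" "kernel G Q h = N"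
      using ex_quotient[OF N(1)] .
    have ordG: "order Q * q = order G" using group_hom.order_kernel[OF Q(1,2)] Q(3) N(3) by simp
    have cop: "coprime (order Q) q"
    proof -
      have "\<not> q dvd order Q"
      proof
        assume "q dvd order Q"
        hence "q ^ 2 dvd order G" unfolding ordG[symmetric] power2_eq_square by (intro mult_dvd_mono) auto
        thus False using sq N(2) squarefreeD not_prime_unit by blast
      qed
      thus ?thesis using N(2) by (simp add: prime_imp_coprime coprime_commute)
    qed
    interpret Q: prime_kernel_hom G Q h q
      using Q N(2,3) fin cop by (simp add: prime_kernel_hom_def prime_kernel_hom_axioms_def)
    have "order Q > 0" using Q.H.order_gt_0_iff_finite Q.finite_H by blast
    hence "order Q < order G" unfolding ordG[symmetric] using N(2) prime_gt_1_nat by simp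
    moreover have sqQ: "squarefree (order Q)" using sq ordG by (metis squarefree_multD(1))
    ultimately consider "cyclic_group Q" | "5 * 2 ^ num_prime_divisors Q \<le> 4 * cyc Q"
      using less.hyps[of Q] Q.H.is_group Q.finite_H by blast
    thus ?thesis
    proof cases
      case 1
      thus ?thesis using Q.cyc_ge_if_cyclic_quotient sqQ by blast
    next
      case 2
      thus ?thesis using Q.two_cyc_le by (simp add: Q.num_prime_divisors_G)
    qed
  qed
qed

theorem theorem3p2:
  fixes G :: "('a, 'b) monoid_scheme" (structure)
  assumes "group G"
    and "finite (carrier G)"
    and "eta G < 5 / 4"
  shows "eta G = 1 \<and> cyclic_group G \<and> squarefree (order G)"
proof -
  interpret group G by fact
  let ?r = "num_prime_divisors G"
  have pos: "order G > 0" using order_gt_0_iff_finite assms(2) by blast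
  have "real (4 * cyc G) < real (5 * 2 ^ ?r)" using assms(3) by (simp add: eta_def field_simps)
  hence lt: "4 * cyc G < 5 * 2 ^ ?r" by (simp only: of_nat_less_iff)
  note bounds = card_divisors_bounds[OF pos, folded num_prime_divisors_def]
  have sq: "squarefree (order G)"
  proof (rule ccontr)
    assume "\<not> squarefree (order G)"
    hence "3 * 2 ^ ?r \<le> 2 * card {d. d dvd order G}" using bounds by blast
    hence "3 * 2 ^ ?r \<le> 2 * cyc G" using card_divisors_le_cyc[OF assms(2)] by linarith
    thus False using lt by simp
  qed
  have cyclic: "cyclic_group G"
    using squarefree_cyclic_or_cyc_ge[OF assms(1,2) sq] lt by simp
  have "cyc G = 2 ^ ?r"
    using bounds sq card_divisors_le_cyc[OF assms(2)] cyc_le_card_divisors[OF assms(2) cyclic]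
    by simp
  hence "eta G = 1" by (simp add: eta_def)
  thus ?thesis using cyclic sq by blast
qed

end
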